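(* Given positive integers $m\le n$ and $w$, let $G$ be an equitable domination graph with $m$ left and $n$ right vertices. Whether there exists a $G$-dominating injective map $\{0,1\}^m\to\mathcal{B}(n,w)$ can be determined in time polynomial in $m$ and $w$ (by solving a linear program with $O(m^2w^2)$ variables and $O(m^2+w^2)$ constraints whose optimal value equals the size of a maximum matching in the compatibility graph defined by $G$).
   Context: For $y \in \{0,1\}^n$, $\mathrm{wt}(y)$ is the number of nonzero coordinates, and $\mathcal{B}(n,w)=\{y\in\{0,1\}^n : \mathrm{wt}(y)\le w\}$. A domination graph is a bipartite graph $G=([m]\cup[n],E)$ with left vertex set $[m]$ and right vertex set $[n]$ having no isolated right vertices. An injective map $\varphi:\{0,1\}^m\to\mathcal{B}(n,w)$ is $G$-dominating if for every $x\in\{0,1\}^m$ and every edge $(i,j)\in E$: $x_i=0$ implies that the $j$-th coordinate of $\varphi(x)$ is $0$. A domination graph is equitable if every right vertex has degree exactly one and every left vertex has degree $\lfloor n/m\rfloor$ or $\lceil n/m\rceil$ (all such graphs are isomorphic up to permuting left and right vertices). The compatibility graph defined by $G$ is the bipartite graph on $\{0,1\}^m\cup\mathcal{B}(n,w)$ in which $x$ is adjacent to $y$ iff for every $(i,j)\in E$, $x_i=0$ implies $y_j=0$. *)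

theory Defs
  imports Complex_Main "HOL-Library.FuncSet"
begin

text \<open>Binary words of length \<open>n\<close> are extensional functions on \<open>{1..n}\<close>.\<close>

definition cube :: "nat \<Rightarrow> (nat \<Rightarrow> nat) set" where
  "cube n = ({1..n} \<rightarrow>\<^sub>E {0, 1})"

definition wt :: "nat \<Rightarrow> (nat \<Rightarrow> nat) \<Rightarrow> nat" where
  "wt n y = card {j \<in> {1..n}. y j \<noteq> 0}"

definition hamming_ball :: "nat \<Rightarrow> nat \<Rightarrow> (nat \<Rightarrow> nat) set" where
  "hamming_ball n w = {y \<in> cube n. wt n y \<le> w}"

text \<open>
  A bipartite graph with left vertices \<open>{1..m}\<close> and right vertices \<open>{1..n}\<close> is given by its edge
  set \<open>E\<close>; the first component of an edge is the left endpoint, so that the two sides are disjoint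
  although both consist of numbers.
\<close>

definition domination_graph :: "nat \<Rightarrow> nat \<Rightarrow> (nat \<times> nat) set \<Rightarrow> bool" where
  "domination_graph m n E \<longleftrightarrow>
     E \<subseteq> {1..m} \<times> {1..n} \<and> (\<forall>j\<in>{1..n}. \<exists>i. (i, j) \<in> E)"

definition left_degree :: "(nat \<times> nat) set \<Rightarrow> nat \<Rightarrow> nat" where
  "left_degree E i = card {j. (i, j) \<in> E}"

definition right_degree :: "(nat \<times> nat) set \<Rightarrow> nat \<Rightarrow> nat" where
  "right_degree E j = card {i. (i, j) \<in> E}"

definition equitable :: "nat \<Rightarrow> nat \<Rightarrow> (nat \<times> nat) set \<Rightarrow> bool" where
  "equitable m n E \<longleftrightarrow> domination_graph m n E \<and>
     (\<forall>j\<in>{1..n}. right_degree E j = 1) \<and>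
     (\<forall>i\<in>{1..m}. int (left_degree E i) = \<lfloor>real n / real m\<rfloor> \<or>
                  int (left_degree E i) = \<lceil>real n / real m\<rceil>)"

definition compatible :: "(nat \<times> nat) set \<Rightarrow> (nat \<Rightarrow> nat) \<Rightarrow> (nat \<Rightarrow> nat) \<Rightarrow> bool" where
  "compatible E x y \<longleftrightarrow> (\<forall>(i, j)\<in>E. x i = 0 \<longrightarrow> y j = 0)"

definition dominating ::
  "nat \<Rightarrow> nat \<Rightarrow> nat \<Rightarrow> (nat \<times> nat) set \<Rightarrow> ((nat \<Rightarrow> nat) \<Rightarrow> (nat \<Rightarrow> nat)) \<Rightarrow> bool" where
  "dominating m n w E \<phi> \<longleftrightarrow>
     \<phi> \<in> cube m \<rightarrow> hamming_ball n w \<and> inj_on \<phi> (cube m) \<and>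
     (\<forall>x\<in>cube m. compatible E x (\<phi> x))"

definition compatibility_edges ::
  "nat \<Rightarrow> nat \<Rightarrow> nat \<Rightarrow> (nat \<times> nat) set \<Rightarrow> ((nat \<Rightarrow> nat) \<times> (nat \<Rightarrow> nat)) set" where
  "compatibility_edges m n w E =
     {(x, y). x \<in> cube m \<and> y \<in> hamming_ball n w \<and> compatible E x y}"

definition matching :: "('a \<times> 'b) set \<Rightarrow> ('a \<times> 'b) set \<Rightarrow> bool" where
  "matching F M \<longleftrightarrow> M \<subseteq> F \<and> inj_on fst M \<and> inj_on snd M"

definition max_matching_size :: "('a \<times> 'b) set \<Rightarrow> nat" where
  "max_matching_size F = Max (card ` {M. matching F M})"

text \<open>
  Maximise the objective over nonnegative variables subject to finitely many \<open>\<le>\<close>-constraints.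
  Nonnegativity of the variables is not counted among the constraints.
\<close>

record ('v, 'c) linear_program =
  lp_vars :: "'v set"
  lp_constraints :: "'c set"
  lp_objective :: "'v \<Rightarrow> real"
  lp_coeff :: "'c \<Rightarrow> 'v \<Rightarrow> real"
  lp_rhs :: "'c \<Rightarrow> real"

definition lp_feasible :: "('v, 'c) linear_program \<Rightarrow> ('v \<Rightarrow> real) \<Rightarrow> bool" where
  "lp_feasible L z \<longleftrightarrow>
     (\<forall>v\<in>lp_vars L. 0 \<le> z v) \<and>
     (\<forall>c\<in>lp_constraints L. (\<Sum>v\<in>lp_vars L. lp_coeff L c v * z v) \<le> lp_rhs L c)"

definition lp_value :: "('v, 'c) linear_program \<Rightarrow> ('v \<Rightarrow> real) \<Rightarrow> real" where
  "lp_value L z = (\<Sum>v\<in>lp_vars L. lp_objective L v * z v)"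

definition lp_optimal_value :: "('v, 'c) linear_program \<Rightarrow> real \<Rightarrow> bool" where
  "lp_optimal_value L t \<longleftrightarrow>
     (\<exists>z. lp_feasible L z \<and> lp_value L z = t) \<and>
     (\<forall>z. lp_feasible L z \<longrightarrow> lp_value L z \<le> t)"

text \<open>
  The linear program is the fractional matching problem of the compatibility graph, reduced modulo
  the symmetries of an equitable graph. A set of left vertices is classified by how many of its
  elements have degree above \<open>n div m\<close> and how many do not. A word \<open>x\<close> is classified through its
  support, a word \<open>y\<close> through the set of left neighbours of its support; \<open>x\<close> and \<open>y\<close> are compatible
  iff the latter set is contained in the former. The variable indexed by \<open>(p, q)\<close> is the total
  weight of the edges between the class \<open>p\<close> of words \<open>x\<close> and the class \<open>q\<close> of words \<open>y\<close>, and there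
  is one capacity constraint per class.
\<close>

definition profile :: "nat \<Rightarrow> nat \<Rightarrow> (nat \<times> nat) set \<Rightarrow> nat set \<Rightarrow> nat \<times> nat" where
  "profile m n E S =
     (card {i \<in> S. left_degree E i > n div m}, card {i \<in> S. left_degree E i \<le> n div m})"

definition left_profile :: "nat \<Rightarrow> nat \<Rightarrow> (nat \<times> nat) set \<Rightarrow> (nat \<Rightarrow> nat) \<Rightarrow> nat \<times> nat" where
  "left_profile m n E x = profile m n E {i \<in> {1..m}. x i \<noteq> 0}"

definition right_profile :: "nat \<Rightarrow> nat \<Rightarrow> (nat \<times> nat) set \<Rightarrow> (nat \<Rightarrow> nat) \<Rightarrow> nat \<times> nat" where
  "right_profile m n E y = profile m n E {i. \<exists>j. (i, j) \<in> E \<and> y j \<noteq> 0}"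

definition class_lp ::
  "nat \<Rightarrow> nat \<Rightarrow> nat \<Rightarrow> (nat \<times> nat) set \<Rightarrow>
     ((nat \<times> nat) \<times> (nat \<times> nat), (nat \<times> nat) + (nat \<times> nat)) linear_program" where
  "class_lp m n w E =
     (let P = left_profile m n E ` cube m;
          Q = right_profile m n E ` hamming_ball n w
      in \<lparr>lp_vars = {(p, q). p \<in> P \<and> q \<in> Q \<and> fst q \<le> fst p \<and> snd q \<le> snd p},
          lp_constraints = P <+> Q,
          lp_objective = (\<lambda>_. 1),
          lp_coeff = (\<lambda>c (p, q). case c of Inl p' \<Rightarrow> of_bool (p = p') | Inr q' \<Rightarrow> of_bool (q = q')),
          lp_rhs = (\<lambda>c. case c of
              Inl p \<Rightarrow> real (card {x \<in> cube m. left_profile m n E x = p})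
            | Inr q \<Rightarrow> real (card {y \<in> hamming_ball n w. right_profile m n E y = q}))\<rparr>)"

text \<open>
  Structured programs for a random access machine whose registers, addressed by natural numbers,
  hold natural numbers. \<open>Load a b\<close> and \<open>Store a b\<close> are the indirect accesses \<open>R[a] := R[R[b]]\<close> and
  \<open>R[R[a]] := R[b]\<close>; tests ask whether a register is nonzero. Subtraction is truncated and
  \<open>k div 0 = 0\<close>.
\<close>

datatype arith_op = Add | Sub | Mul | Div

fun arith :: "arith_op \<Rightarrow> nat \<Rightarrow> nat \<Rightarrow> nat" where
  "arith Add x y = x + y"
| "arith Sub x y = x - y"
| "arith Mul x y = x * y"
| "arith Div x y = x div y"

datatype program =
    Skip
  | Const nat nat
  | Arith arith_op nat nat nat
  | Load nat nat
  | Store nat nat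
  | Seq program program
  | If nat program program
  | While nat program

text \<open>
  \<open>exec B c s t s'\<close>: program \<open>c\<close> started in memory \<open>s\<close> terminates in memory \<open>s'\<close> after \<open>t\<close>
  elementary steps, and no value written to a register during the run exceeds \<open>B\<close>. Since
  multiplication is a single step, counting steps measures running time up to a polynomial only
  together with a bound on the length of the numbers involved.
\<close>

inductive exec :: "nat \<Rightarrow> program \<Rightarrow> (nat \<Rightarrow> nat) \<Rightarrow> nat \<Rightarrow> (nat \<Rightarrow> nat) \<Rightarrow> bool" for B :: nat where
  Skip: "exec B Skip s 1 s"
| Const: "k \<le> B \<Longrightarrow> exec B (Const a k) s 1 (s(a := k))"
| Arith: "arith f (s b) (s c) \<le> B \<Longrightarrow> exec B (Arith f a b c) s 1 (s(a := arith f (s b) (s c)))"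
| Load: "s (s b) \<le> B \<Longrightarrow> exec B (Load a b) s 1 (s(a := s (s b)))"
| Store: "s b \<le> B \<Longrightarrow> exec B (Store a b) s 1 (s(s a := s b))"
| Seq: "exec B p s t s' \<Longrightarrow> exec B q s' u s'' \<Longrightarrow> exec B (Seq p q) s (t + u) s''"
| IfTrue: "s a \<noteq> 0 \<Longrightarrow> exec B p s t s' \<Longrightarrow> exec B (If a p q) s (t + 1) s'"
| IfFalse: "s a = 0 \<Longrightarrow> exec B q s t s' \<Longrightarrow> exec B (If a p q) s (t + 1) s'"
| WhileTrue: "s a \<noteq> 0 \<Longrightarrow> exec B p s t s' \<Longrightarrow> exec B (While a p) s' u s'' \<Longrightarrow>
    exec B (While a p) s (t + u + 1) s''"
| WhileFalse: "s a = 0 \<Longrightarrow> exec B (While a p) s 1 s"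

definition input_memory :: "nat \<Rightarrow> nat \<Rightarrow> nat \<Rightarrow> nat \<Rightarrow> nat" where
  "input_memory m n w = (\<lambda>_. 0)(0 := m, 1 := n, 2 := w)"

text \<open>
  At most \<open>T\<close> steps on numbers of at most \<open>T * log 2 (n + 1)\<close> bits; the factor \<open>log 2 (n + 1)\<close>
  accounts for the length of the input \<open>n\<close> itself. With \<open>T\<close> polynomial in \<open>m\<close> and \<open>w\<close> this is
  the usual notion of a number of arithmetic operations independent of \<open>n\<close>, on numbers of
  polynomial length.
\<close>

definition runs_within ::
  "nat \<Rightarrow> program \<Rightarrow> nat \<Rightarrow> nat \<Rightarrow> nat \<Rightarrow> (nat \<Rightarrow> nat) \<Rightarrow> bool" where
  "runs_within T p m n w s \<longleftrightarrow>
     (\<exists>t\<le>T. exec ((n + 1) ^ T) p (input_memory m n w) t s)"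

end

theory Submission
  imports Defs "HOL-Library.Disjoint_Sets"
begin

text \<open>
  Spreading the weight of a pair of classes evenly over its edges shows, via Koenig's theorem, that
  the class program computes the maximum matching size of every biregular graph that induces the
  same relation between classes. One such graph is the compatibility graph; another joins \<open>x\<close> and
  \<open>y\<close> whenever the profile of \<open>y\<close> is componentwise at most that of \<open>x\<close>. Minimum vertex covers of
  the second graph are given by down-sets of profiles, that is by staircases in an
  \<open>(a + 1) \<times> (b + 1)\<close> grid, and a dynamic program finds the cheapest staircase. The class sizes it
  needs come from the integer \<open>G\<^sub>1 ^ i * G\<^sub>0 ^ j\<close>, where \<open>G\<^sub>1\<close> and \<open>G\<^sub>0\<close> are the generating
  functions of the nonempty subsets of a block, evaluated at a large integer.
\<close>

subsection \<open>Matchings and the quotient linear program\<close>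

text \<open>The number of steps must not depend on \<open>n\<close>, although the class sizes do: a
  block has about \<open>n / m\<close> elements. Hence the generating functions of the blocks are
  cut off at degree \<open>w\<close>, and \<open>n\<close> enters only through their binomial
  coefficients. Packing a polynomial into one integer turns products of polynomials into single
  multiplications and the sum of the coefficients of degree at most \<open>w\<close> into two
  remainders; the price is numbers whose length is polynomial in \<open>m\<close>, \<open>w\<close>
  and the length of \<open>n\<close>. The second graph is introduced because its neighbourhoods are
  unions of whole classes, whereas those of the compatibility graph depend on inclusions between
  individual sets. In the second graph the profiles of the left words missed by a cover generate a
  down-set, which alone determines a cover that is at least as cheap. Both matching sizes are
  optimal values of the same program and therefore equal, so the machine finds the optimum of the
  program by purely combinatorial means.\<close>

lemma matching_of_cover_bound:
  assumes "finite F"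
    and "\<And>A B. finite A \<Longrightarrow> finite B \<Longrightarrow> \<forall>e\<in>F. fst e \<in> A \<or> snd e \<in> B \<Longrightarrow> k \<le> card A + card B"
  shows "\<exists>M. matching F M \<and> k \<le> card M"
  using assms
proof (induction F rule: finite_psubset_induct)
  case (psubset F)
  \<comment> \<open>An edge is robust if its deletion keeps every cover at size at least
    \<open>k\<close>. Deleting robust edges is the induction; when none is left, each edge
    \<open>e\<close> has a cover of the remaining edges that is smaller than \<open>k\<close> and
    misses both ends of \<open>e\<close>.\<close>
  define robust where "robust e \<longleftrightarrow> (\<forall>A B. finite A \<longrightarrow> finite B \<longrightarrow>
      (\<forall>e'\<in>F - {e}. fst e' \<in> A \<or> snd e' \<in> B) \<longrightarrow> k \<le> card A + card B)" for e
  show ?case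
  proof (cases "\<exists>e\<in>F. robust e")
    case True
    then obtain e where e: "e \<in> F" "robust e"
      by blast
    then have "\<exists>M. matching (F - {e}) M \<and> k \<le> card M"
      by (intro psubset.IH) (auto simp: robust_def)
    then show ?thesis
      unfolding matching_def by blast
  next
    case False
    have small: "\<exists>A B. finite A \<and> finite B \<and> (\<forall>e'\<in>F. e' \<noteq> e \<longrightarrow> fst e' \<in> A \<or> snd e' \<in> B) \<and>
        fst e \<notin> A \<and> snd e \<notin> B \<and> card A + card B < k"
      if "e \<in> F" for e
    proof -
      have "\<not> robust e"
        using False \<open>e \<in> F\<close> by blast
      then obtain A B where AB: "finite A" "finite B" "\<forall>e'\<in>F - {e}. fst e' \<in> A \<or> snd e' \<in> B"
        "\<not> k \<le> card A + card B"
        unfolding robust_def by blast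
      have "\<not> (fst e \<in> A \<or> snd e \<in> B)"
      proof
        assume "fst e \<in> A \<or> snd e \<in> B"
        then have "\<forall>e'\<in>F. fst e' \<in> A \<or> snd e' \<in> B" using AB(3) by auto
        then show False using psubset.prems AB by blast
      qed
      moreover have "\<forall>e'\<in>F. e' \<noteq> e \<longrightarrow> fst e' \<in> A \<or> snd e' \<in> B" using AB(3) by auto
      ultimately show ?thesis
        using AB not_le by (intro exI[of _ A] exI[of _ B]) auto
    qed
    have bound: "k \<le> card A + card B"
      if "finite A" "finite B" "\<And>e. e \<in> F \<Longrightarrow> fst e \<in> A \<or> snd e \<in> B" for A B
      using psubset.prems that by blast
    \<comment> \<open>Uncrossing: if two critical edges shared a vertex, then intersecting their
      small covers on its side and uniting them on the other, and the reverse with the shared vertex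
      added, would give two covers of total size at most \<open>2 * (k - 1) + 1\<close>, while each
      needs \<open>k\<close>. So no two edges touch and \<open>F\<close> is itself a
      matching.\<close>
    have "fst e1 \<noteq> fst e2 \<and> snd e1 \<noteq> snd e2" if e: "e1 \<in> F" "e2 \<in> F" "e1 \<noteq> e2" for e1 e2
    proof -
      obtain A1 B1 where 1: "finite A1" "finite B1" "\<forall>e\<in>F. e \<noteq> e1 \<longrightarrow> fst e \<in> A1 \<or> snd e \<in> B1"
        "fst e1 \<notin> A1" "snd e1 \<notin> B1" "card A1 + card B1 < k"
        using small[OF e(1)] by blast
      obtain A2 B2 where 2: "finite A2" "finite B2" "\<forall>e\<in>F. e \<noteq> e2 \<longrightarrow> fst e \<in> A2 \<or> snd e \<in> B2"
        "fst e2 \<notin> A2" "snd e2 \<notin> B2" "card A2 + card B2 < k"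
        using small[OF e(2)] by blast
      have "\<not> fst e1 = fst e2"
      proof
        assume eq: "fst e1 = fst e2"
        have cov: "fst e \<in> A1 \<inter> A2 \<or> snd e \<in> B1 \<union> B2" if "e \<in> F" for e
        proof (cases "e = e1 \<or> e = e2")
          case True
          then show ?thesis using 1(3,4) 2(3,4) e eq by auto
        next
          case False
          then show ?thesis using 1(3) 2(3) that by auto
        qed
        have "k \<le> card (A1 \<inter> A2) + card (B1 \<union> B2)"
          using cov by (intro bound) (use 1 2 in auto)
        moreover have "k \<le> card (insert (fst e1) (A1 \<union> A2)) + card (B1 \<inter> B2)"
          using 1(3) 2(3) eq by (intro bound) (use 1(1,2) 2(1,2) in auto)
        then have "k \<le> Suc (card (A1 \<union> A2)) + card (B1 \<inter> B2)"
          using 1(1,4) 2(1,4) eq by simp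
        ultimately show False
          using card_Un_Int[OF 1(1) 2(1)] card_Un_Int[OF 1(2) 2(2)] 1(6) 2(6) by linarith
      qed
      moreover have "\<not> snd e1 = snd e2"
      proof
        assume eq: "snd e1 = snd e2"
        have cov: "fst e \<in> A1 \<union> A2 \<or> snd e \<in> B1 \<inter> B2" if "e \<in> F" for e
        proof (cases "e = e1 \<or> e = e2")
          case True
          then show ?thesis using 1(3,5) 2(3,5) e eq by auto
        next
          case False
          then show ?thesis using 1(3) 2(3) that by auto
        qed
        have "k \<le> card (A1 \<union> A2) + card (B1 \<inter> B2)"
          using cov by (intro bound) (use 1 2 in auto)
        moreover have "k \<le> card (A1 \<inter> A2) + card (insert (snd e1) (B1 \<union> B2))"
          using 1(3) 2(3) eq by (intro bound) (use 1(1,2) 2(1,2) in auto)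
        then have "k \<le> card (A1 \<inter> A2) + Suc (card (B1 \<union> B2))"
          using 1(2,5) 2(2,5) eq by simp
        ultimately show False
          using card_Un_Int[OF 1(1) 2(1)] card_Un_Int[OF 1(2) 2(2)] 1(6) 2(6) by linarith
      qed
      ultimately show ?thesis by simp
    qed
    then have inj: "inj_on fst F" "inj_on snd F"
      unfolding inj_on_def by blast+
    have "k \<le> card (fst ` F)"
      using bound[of "fst ` F" "{}"] \<open>finite F\<close> by simp
    then have "k \<le> card F"
      using inj by (simp add: card_image)
    then show ?thesis
      using inj by (intro exI[of _ F]) (simp add: matching_def)
  qed
qed

lemma max_matching_size:
  assumes "finite F"
  shows "matching F M \<Longrightarrow> card M \<le> max_matching_size F"
    and "\<exists>M. matching F M \<and> card M = max_matching_size F"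
proof -
  have fin: "finite {M. matching F M}"
    by (rule finite_subset[of _ "Pow F"]) (use assms in \<open>auto simp: matching_def\<close>)
  show "matching F M \<Longrightarrow> card M \<le> max_matching_size F"
    unfolding max_matching_size_def using fin by (intro Max_ge) auto
  have "matching F {}"
    by (simp add: matching_def)
  then have "max_matching_size F \<in> card ` {M. matching F M}"
    unfolding max_matching_size_def using fin by (intro Max_in) auto
  then show "\<exists>M. matching F M \<and> card M = max_matching_size F"
    by auto
qed

lemma matching_le_cover:
  assumes "matching F M" "finite A" "finite B" "\<forall>e\<in>F. fst e \<in> A \<or> snd e \<in> B"
  shows "card M \<le> card A + card B"
proof -
  have M: "M \<subseteq> F" "inj_on fst M" "inj_on snd M"
    using assms(1) by (simp_all add: matching_def)
  let ?MA = "{e \<in> M. fst e \<in> A}" and ?MB = "{e \<in> M. snd e \<in> B}"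
  have "card ?MA \<le> card A"
    using assms(2) M(2) by (intro card_inj_on_le[of fst]) (auto simp: inj_on_def)
  moreover have "card ?MB \<le> card B"
    using assms(3) M(3) by (intro card_inj_on_le[of snd]) (auto simp: inj_on_def)
  moreover have "M = ?MA \<union> ?MB"
    using assms(4) M(1) by auto
  then have "card M = card (?MA \<union> ?MB)"
    by (rule arg_cong)
  ultimately show ?thesis
    using card_Un_le[of ?MA ?MB] by linarith
qed

text \<open>Taking \<open>k\<close> one above the maximum matching size,
  \<open>matching_of_cover_bound\<close> would yield too large a matching, so some cover is no
  larger than the maximum; \<open>matching_le_cover\<close> gives the other inequality.\<close>

theorem koenig:
  assumes "finite F"
  obtains A B where "finite A" "finite B" "\<forall>e\<in>F. fst e \<in> A \<or> snd e \<in> B"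
    "card A + card B = max_matching_size F"
proof -
  define big where "big A B \<longleftrightarrow> Suc (max_matching_size F) \<le> card A + card B" for A :: "'a set" and B :: "'b set"
  have "\<exists>A B. finite A \<and> finite B \<and> (\<forall>e\<in>F. fst e \<in> A \<or> snd e \<in> B) \<and> \<not> big A B"
  proof (rule ccontr)
    assume "\<not> ?thesis"
    then have "finite A \<Longrightarrow> finite B \<Longrightarrow> \<forall>e\<in>F. fst e \<in> A \<or> snd e \<in> B \<Longrightarrow> big A B" for A B
      by blast
    then have "\<exists>M. matching F M \<and> Suc (max_matching_size F) \<le> card M"
      unfolding big_def by (rule matching_of_cover_bound[OF assms])
    then show False
      using max_matching_size(1)[OF assms] not_less_eq_eq by blast
  qed
  then obtain A B where AB: "finite A" "finite B" "\<forall>e\<in>F. fst e \<in> A \<or> snd e \<in> B"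
    "\<not> Suc (max_matching_size F) \<le> card A + card B"
    unfolding big_def by (elim exE conjE) (rule that)
  obtain M where "matching F M" "card M = max_matching_size F"
    using max_matching_size(2)[OF assms] by blast
  then have "max_matching_size F \<le> card A + card B"
    using matching_le_cover[OF _ AB(1-3), of M] by simp
  then show thesis
    using AB(4) by (intro that[OF AB(1-3)]) simp
qed

text \<open>The class program freed from words and profiles. The edge set does not occur in it, only
  the relation \<open>r\<close> between classes, so that one optimality theorem applies to several
  graphs.\<close>

definition quotient_lp ::
  "'x set \<Rightarrow> 'y set \<Rightarrow> ('x \<Rightarrow> 'p) \<Rightarrow> ('y \<Rightarrow> 'q) \<Rightarrow> ('p \<Rightarrow> 'q \<Rightarrow> bool) \<Rightarrow> ('p \<times> 'q, 'p + 'q) linear_program"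
  where "quotient_lp X Y f g r =
    \<lparr>lp_vars = {(p, q). p \<in> f ` X \<and> q \<in> g ` Y \<and> r p q},
     lp_constraints = f ` X <+> g ` Y,
     lp_objective = (\<lambda>_. 1),
     lp_coeff = (\<lambda>c (p, q). case c of Inl p' \<Rightarrow> of_bool (p = p') | Inr q' \<Rightarrow> of_bool (q = q')),
     lp_rhs = (\<lambda>c. case c of
         Inl p \<Rightarrow> real (card {x \<in> X. f x = p})
       | Inr q \<Rightarrow> real (card {y \<in> Y. g y = q}))\<rparr>"

lemma class_lp_eq_quotient_lp:
  "class_lp m n w E = quotient_lp (cube m) (hamming_ball n w) (left_profile m n E) (right_profile m n E)
     (\<lambda>p q. fst q \<le> fst p \<and> snd q \<le> snd p)"
  unfolding class_lp_def quotient_lp_def Let_def by simp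

lemma lp_feasible_quotient_lp:
  assumes "finite X" "finite Y"
  shows "lp_feasible (quotient_lp X Y f g r) z \<longleftrightarrow>
    (\<forall>p\<in>f ` X. \<forall>q\<in>g ` Y. r p q \<longrightarrow> 0 \<le> z (p, q)) \<and>
    (\<forall>p\<in>f ` X. (\<Sum>q | q \<in> g ` Y \<and> r p q. z (p, q)) \<le> card {x \<in> X. f x = p}) \<and>
    (\<forall>q\<in>g ` Y. (\<Sum>p | p \<in> f ` X \<and> r p q. z (p, q)) \<le> card {y \<in> Y. g y = q})"
proof -
  let ?V = "{(p, q). p \<in> f ` X \<and> q \<in> g ` Y \<and> r p q}"
  have fin: "finite ?V"
    by (rule finite_subset[of _ "f ` X \<times> g ` Y"]) (use assms in auto)
  have "(\<Sum>v\<in>?V. (case v of (p', q) \<Rightarrow> of_bool (p' = p)) * z v) = (\<Sum>q | q \<in> g ` Y \<and> r p q. z (p, q))"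
    if "p \<in> f ` X" for p
  proof -
    have "(\<Sum>v\<in>?V. (case v of (p', q) \<Rightarrow> of_bool (p' = p)) * z v) = (\<Sum>v\<in>{v \<in> ?V. fst v = p}. z v)"
      using fin by (intro sum.mono_neutral_cong_right) auto
    also have "\<dots> = (\<Sum>q | q \<in> g ` Y \<and> r p q. z (p, q))"
      using that by (intro sum.reindex_bij_witness[of _ "Pair p" snd]) auto
    finally show ?thesis .
  qed
  moreover have "(\<Sum>v\<in>?V. (case v of (p, q') \<Rightarrow> of_bool (q' = q)) * z v) = (\<Sum>p | p \<in> f ` X \<and> r p q. z (p, q))"
    if "q \<in> g ` Y" for q
  proof -
    have "(\<Sum>v\<in>?V. (case v of (p, q') \<Rightarrow> of_bool (q' = q)) * z v) = (\<Sum>v\<in>{v \<in> ?V. snd v = q}. z v)"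
      using fin by (intro sum.mono_neutral_cong_right) auto
    also have "\<dots> = (\<Sum>p | p \<in> f ` X \<and> r p q. z (p, q))"
      using that by (intro sum.reindex_bij_witness[of _ "\<lambda>p. (p, q)" fst]) auto
    finally show ?thesis .
  qed
  ultimately show ?thesis
    unfolding lp_feasible_def quotient_lp_def by (auto simp: Plus_def ball_Un)
qed

lemma lp_value_quotient_lp:
  "lp_value (quotient_lp X Y f g r) z = (\<Sum>v\<in>{(p, q). p \<in> f ` X \<and> q \<in> g ` Y \<and> r p q}. z v)"
  by (simp add: lp_value_def quotient_lp_def)

lemma lp_optimal_value_unique:
  "lp_optimal_value L s \<Longrightarrow> lp_optimal_value L t \<Longrightarrow> s = t"
  unfolding lp_optimal_value_def by (metis order_antisym)

lemma sum_card_fibres: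
  assumes "finite A" "finite B" "h ` A \<subseteq> B"
  shows "(\<Sum>b\<in>B. card {a \<in> A. h a = b}) = card A"
  using sum.group[OF assms, of "\<lambda>_. 1 :: nat"] by simp

text \<open>The number of matching edges between two classes is a feasible choice, because each
  vertex carries at most one edge of the matching.\<close>

lemma quotient_lp_matching:
  assumes fin: "finite X" "finite Y" and M: "matching F M" "F \<subseteq> X \<times> Y"
    and r: "\<And>x y. (x, y) \<in> F \<Longrightarrow> r (f x) (g y)"
  shows "\<exists>z. lp_feasible (quotient_lp X Y f g r) z \<and> lp_value (quotient_lp X Y f g r) z = card M"
proof (intro exI conjI)
  define z where "z v = real (card {e \<in> M. (f (fst e), g (snd e)) = v})" for v
  have finM: "finite M" and MXY: "M \<subseteq> X \<times> Y" and inj: "inj_on fst M" "inj_on snd M"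
    using M fin by (auto simp: matching_def dest: finite_subset)
  have Mr: "r (f (fst e)) (g (snd e))" if "e \<in> M" for e
    using that M r by (cases e) (auto simp: matching_def)
  have "(\<Sum>q | q \<in> g ` Y \<and> r p q. z (p, q)) \<le> card {x \<in> X. f x = p}" for p
  proof -
    have "(\<Sum>q | q \<in> g ` Y \<and> r p q. z (p, q)) =
        real (\<Sum>q | q \<in> g ` Y \<and> r p q. card {e \<in> {e \<in> M. f (fst e) = p}. g (snd e) = q})"
      unfolding z_def of_nat_sum by (intro sum.cong refl arg_cong[of _ _ "\<lambda>A. real (card A)"]) auto
    also have "(\<Sum>q | q \<in> g ` Y \<and> r p q. card {e \<in> {e \<in> M. f (fst e) = p}. g (snd e) = q})
        = card {e \<in> M. f (fst e) = p}"
      using fin finM MXY Mr by (intro sum_card_fibres) auto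
    also have "\<dots> \<le> card {x \<in> X. f x = p}"
      using fin MXY inj by (intro card_inj_on_le[of fst]) (auto simp: inj_on_def)
    finally show ?thesis by simp
  qed
  moreover have "(\<Sum>p | p \<in> f ` X \<and> r p q. z (p, q)) \<le> card {y \<in> Y. g y = q}" for q
  proof -
    have "(\<Sum>p | p \<in> f ` X \<and> r p q. z (p, q)) =
        real (\<Sum>p | p \<in> f ` X \<and> r p q. card {e \<in> {e \<in> M. g (snd e) = q}. f (fst e) = p})"
      unfolding z_def of_nat_sum by (intro sum.cong refl arg_cong[of _ _ "\<lambda>A. real (card A)"]) auto
    also have "(\<Sum>p | p \<in> f ` X \<and> r p q. card {e \<in> {e \<in> M. g (snd e) = q}. f (fst e) = p})
        = card {e \<in> M. g (snd e) = q}"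
      using fin finM MXY Mr by (intro sum_card_fibres) auto
    also have "\<dots> \<le> card {y \<in> Y. g y = q}"
      using fin MXY inj by (intro card_inj_on_le[of snd]) (auto simp: inj_on_def)
    finally show ?thesis by simp
  qed
  ultimately show "lp_feasible (quotient_lp X Y f g r) z"
    using fin by (simp add: lp_feasible_quotient_lp z_def)
  let ?V = "{(p, q). p \<in> f ` X \<and> q \<in> g ` Y \<and> r p q}"
  have "(\<Sum>v\<in>?V. card {e \<in> M. (f (fst e), g (snd e)) = v}) = card M"
  proof (rule sum_card_fibres)
    show "finite ?V"
      by (rule finite_subset[of _ "f ` X \<times> g ` Y"]) (use fin in auto)
  qed (use finM MXY Mr in auto)
  then show "lp_value (quotient_lp X Y f g r) z = card M"
    unfolding lp_value_quotient_lp z_def of_nat_sum[symmetric] by simp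
qed

text \<open>
  Spreading the weight of a pair of classes evenly over the edges between them turns a feasible
  solution into a fractional matching, by biregularity.
\<close>

lemma quotient_lp_le_cover:
  assumes fin: "finite X" "finite Y" and F: "F \<subseteq> X \<times> Y"
    and edge: "\<And>p q. p \<in> f ` X \<Longrightarrow> q \<in> g ` Y \<Longrightarrow> r p q \<Longrightarrow> \<exists>(x, y)\<in>F. f x = p \<and> g y = q"
    and rF: "\<And>x y. (x, y) \<in> F \<Longrightarrow> r (f x) (g y)"
    and regX: "\<And>x x' q. x \<in> X \<Longrightarrow> x' \<in> X \<Longrightarrow> f x = f x' \<Longrightarrow>
      card {y. (x, y) \<in> F \<and> g y = q} = card {y. (x', y) \<in> F \<and> g y = q}"
    and regY: "\<And>y y' p. y \<in> Y \<Longrightarrow> y' \<in> Y \<Longrightarrow> g y = g y' \<Longrightarrow>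
      card {x. (x, y) \<in> F \<and> f x = p} = card {x. (x, y') \<in> F \<and> f x = p}"
    and AB: "finite A" "finite B" "\<forall>e\<in>F. fst e \<in> A \<or> snd e \<in> B"
    and z: "lp_feasible (quotient_lp X Y f g r) z"
  shows "lp_value (quotient_lp X Y f g r) z \<le> card A + card B"
proof -
  let ?V = "{(p, q). p \<in> f ` X \<and> q \<in> g ` Y \<and> r p q}"
  define cls where "cls e = (f (fst e), g (snd e))" for e
  define num where "num v = card {e \<in> F. cls e = v}" for v
  define u where "u e = z (cls e) / num (cls e)" for e
  have finF: "finite F" using F fin by (auto dest: finite_subset)
  have finV: "finite ?V"
    by (rule finite_subset[of _ "f ` X \<times> g ` Y"]) (use fin in auto)
  have num_pos: "num v > 0" if "v \<in> ?V" for v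
    using edge[of "fst v" "snd v"] that finF unfolding num_def by (fastforce simp: card_gt_0_iff cls_def)
  have cls_V: "cls e \<in> ?V" if "e \<in> F" for e
    using that rF F by (cases e) (auto simp: cls_def)
  have z0: "z v \<ge> 0" if "v \<in> ?V" for v
    using z that unfolding lp_feasible_quotient_lp[OF fin] by auto
  have u0: "u e \<ge> 0" if "e \<in> F" for e
    using z0[OF cls_V[OF that]] by (simp add: u_def)
  \<comment> \<open>By \<open>regX\<close> all members of the class of \<open>x\<close> have equally
    many edges into class \<open>q\<close>. The even share \<open>u\<close> therefore gives the
    edges from \<open>x\<close> into \<open>q\<close> the total weight \<open>z (f x, q)\<close>
    divided by the size of the class of \<open>x\<close>.\<close>
  have num_X: "num (f x, q) = card {x' \<in> X. f x' = f x} * card {y. (x, y) \<in> F \<and> g y = q}"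
    if "x \<in> X" for x q
  proof -
    have "num (f x, q) = (\<Sum>x'\<in>{x' \<in> X. f x' = f x}. card {e \<in> {e \<in> F. cls e = (f x, q)}. fst e = x'})"
      unfolding num_def using fin F finF by (subst sum_card_fibres) (auto simp: cls_def)
    also have "\<dots> = (\<Sum>x'\<in>{x' \<in> X. f x' = f x}. card {y. (x, y) \<in> F \<and> g y = q})"
    proof (intro sum.cong refl)
      fix x' assume x': "x' \<in> {x' \<in> X. f x' = f x}"
      have "card {e \<in> {e \<in> F. cls e = (f x, q)}. fst e = x'} = card {y. (x', y) \<in> F \<and> g y = q}"
        using x' by (intro bij_betw_same_card[of snd] bij_betw_byWitness[where f' = "Pair x'"])
          (auto simp: cls_def)
      also have "\<dots> = card {y. (x, y) \<in> F \<and> g y = q}"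
        using x' that by (intro regX) auto
      finally show "card {e \<in> {e \<in> F. cls e = (f x, q)}. fst e = x'} = card {y. (x, y) \<in> F \<and> g y = q}" .
    qed
    finally show ?thesis by simp
  qed
  have num_Y: "num (p, g y) = card {y' \<in> Y. g y' = g y} * card {x. (x, y) \<in> F \<and> f x = p}"
    if "y \<in> Y" for p y
  proof -
    have "num (p, g y) = (\<Sum>y'\<in>{y' \<in> Y. g y' = g y}. card {e \<in> {e \<in> F. cls e = (p, g y)}. snd e = y'})"
      unfolding num_def using fin F finF by (subst sum_card_fibres) (auto simp: cls_def)
    also have "\<dots> = (\<Sum>y'\<in>{y' \<in> Y. g y' = g y}. card {x. (x, y) \<in> F \<and> f x = p})"
    proof (intro sum.cong refl)
      fix y' assume y': "y' \<in> {y' \<in> Y. g y' = g y}"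
      have "card {e \<in> {e \<in> F. cls e = (p, g y)}. snd e = y'} = card {x. (x, y') \<in> F \<and> f x = p}"
        using y' by (intro bij_betw_same_card[of fst] bij_betw_byWitness[where f' = "\<lambda>x. (x, y')"])
          (auto simp: cls_def)
      also have "\<dots> = card {x. (x, y) \<in> F \<and> f x = p}"
        using y' that by (intro regY) auto
      finally show "card {e \<in> {e \<in> F. cls e = (p, g y)}. snd e = y'} = card {x. (x, y) \<in> F \<and> f x = p}" .
    qed
    finally show ?thesis by simp
  qed
  have u_X: "(\<Sum>e | e \<in> F \<and> fst e = x. u e) \<le> 1" if x: "x \<in> X" for x
  proof -
    let ?Q = "{q. q \<in> g ` Y \<and> r (f x) q}" and ?c = "real (card {x' \<in> X. f x' = f x})"
    have c: "?c > 0" using x fin by (auto simp: card_gt_0_iff)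
    have "(\<Sum>e | e \<in> F \<and> fst e = x. u e) =
        (\<Sum>q\<in>?Q. \<Sum>e\<in>{e \<in> {e \<in> F. fst e = x}. g (snd e) = q}. u e)"
      using finF fin F rF by (intro sum.group[symmetric]) auto
    also have "\<dots> = (\<Sum>q\<in>?Q. z (f x, q) / ?c)"
    proof (intro sum.cong refl)
      fix q assume q: "q \<in> ?Q"
      have "(\<Sum>e\<in>{e \<in> {e \<in> F. fst e = x}. g (snd e) = q}. u e) =
          (\<Sum>e\<in>{e \<in> {e \<in> F. fst e = x}. g (snd e) = q}. z (f x, q) / num (f x, q))"
        by (intro sum.cong) (auto simp: u_def cls_def)
      also have "\<dots> = real (card {e \<in> {e \<in> F. fst e = x}. g (snd e) = q}) * (z (f x, q) / num (f x, q))"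
        by simp
      also have "card {e \<in> {e \<in> F. fst e = x}. g (snd e) = q} = card {y. (x, y) \<in> F \<and> g y = q}"
        by (intro bij_betw_same_card[of snd] bij_betw_byWitness[where f' = "Pair x"]) auto
      also have "real \<dots> * (z (f x, q) / num (f x, q)) = z (f x, q) / ?c"
        using num_pos[of "(f x, q)"] q x unfolding num_X[OF x] by (auto simp: field_simps)
      finally show "(\<Sum>e\<in>{e \<in> {e \<in> F. fst e = x}. g (snd e) = q}. u e) = z (f x, q) / ?c" .
    qed
    also have "\<dots> = (\<Sum>q\<in>?Q. z (f x, q)) / ?c"
      by (simp add: sum_divide_distrib)
    also have "\<dots> \<le> 1"
      using z x c unfolding lp_feasible_quotient_lp[OF fin] by (simp add: divide_le_eq_1)
    finally show ?thesis .
  qed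
  have u_Y: "(\<Sum>e | e \<in> F \<and> snd e = y. u e) \<le> 1" if y: "y \<in> Y" for y
  proof -
    let ?P = "{p. p \<in> f ` X \<and> r p (g y)}" and ?c = "real (card {y' \<in> Y. g y' = g y})"
    have c: "?c > 0" using y fin by (auto simp: card_gt_0_iff)
    have "(\<Sum>e | e \<in> F \<and> snd e = y. u e) =
        (\<Sum>p\<in>?P. \<Sum>e\<in>{e \<in> {e \<in> F. snd e = y}. f (fst e) = p}. u e)"
      using finF fin F rF by (intro sum.group[symmetric]) auto
    also have "\<dots> = (\<Sum>p\<in>?P. z (p, g y) / ?c)"
    proof (intro sum.cong refl)
      fix p assume p: "p \<in> ?P"
      have "(\<Sum>e\<in>{e \<in> {e \<in> F. snd e = y}. f (fst e) = p}. u e) =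
          (\<Sum>e\<in>{e \<in> {e \<in> F. snd e = y}. f (fst e) = p}. z (p, g y) / num (p, g y))"
        by (intro sum.cong) (auto simp: u_def cls_def)
      also have "\<dots> = real (card {e \<in> {e \<in> F. snd e = y}. f (fst e) = p}) * (z (p, g y) / num (p, g y))"
        by simp
      also have "card {e \<in> {e \<in> F. snd e = y}. f (fst e) = p} = card {x. (x, y) \<in> F \<and> f x = p}"
        by (intro bij_betw_same_card[of fst] bij_betw_byWitness[where f' = "\<lambda>x. (x, y)"]) auto
      also have "real \<dots> * (z (p, g y) / num (p, g y)) = z (p, g y) / ?c"
        using num_pos[of "(p, g y)"] p y unfolding num_Y[OF y] by (auto simp: field_simps)
      finally show "(\<Sum>e\<in>{e \<in> {e \<in> F. snd e = y}. f (fst e) = p}. u e) = z (p, g y) / ?c" .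
    qed
    also have "\<dots> = (\<Sum>p\<in>?P. z (p, g y)) / ?c"
      by (simp add: sum_divide_distrib)
    also have "\<dots> \<le> 1"
      using z y c unfolding lp_feasible_quotient_lp[OF fin] by (simp add: divide_le_eq_1)
    finally show ?thesis .
  qed
  have "lp_value (quotient_lp X Y f g r) z = (\<Sum>v\<in>?V. \<Sum>e\<in>{e \<in> F. cls e = v}. u e)"
    unfolding lp_value_quotient_lp
  proof (intro sum.cong refl)
    fix v assume v: "v \<in> ?V"
    have "(\<Sum>e\<in>{e \<in> F. cls e = v}. u e) = (\<Sum>e\<in>{e \<in> F. cls e = v}. z v / num v)"
      by (intro sum.cong) (auto simp: u_def)
    also have "\<dots> = z v"
      using num_pos[OF v] by (simp add: num_def)
    finally show "z v = (\<Sum>e\<in>{e \<in> F. cls e = v}. u e)" ..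
  qed
  also have "\<dots> = (\<Sum>e\<in>F. u e)"
    by (rule sum.group[OF finF finV image_subsetI]) (rule cls_V)
  \<comment> \<open>Weak duality: each edge is charged to a vertex of the cover, and by
    \<open>u_X\<close> and \<open>u_Y\<close> no vertex is charged more than 1.\<close>
  also have "\<dots> \<le> (\<Sum>e\<in>{e \<in> F. fst e \<in> A \<inter> X} \<union> {e \<in> F. snd e \<in> B \<inter> Y}. u e)"
    proof (intro sum_mono2)
    show "F \<subseteq> {e \<in> F. fst e \<in> A \<inter> X} \<union> {e \<in> F. snd e \<in> B \<inter> Y}"
      using AB F by auto
  qed (use finF u0 in auto)
  also have "\<dots> \<le> (\<Sum>e | e \<in> F \<and> fst e \<in> A \<inter> X. u e) + (\<Sum>e | e \<in> F \<and> snd e \<in> B \<inter> Y. u e)"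
    using finF u0 by (subst sum.union_inter[symmetric]) (auto intro!: sum_nonneg)
  also have "(\<Sum>e | e \<in> F \<and> fst e \<in> A \<inter> X. u e) =
      (\<Sum>x\<in>A \<inter> X. \<Sum>e\<in>{e \<in> {e \<in> F. fst e \<in> A \<inter> X}. fst e = x}. u e)"
    using finF AB by (intro sum.group[symmetric]) auto
  also have "\<dots> = (\<Sum>x\<in>A \<inter> X. \<Sum>e | e \<in> F \<and> fst e = x. u e)"
    by (intro sum.cong refl) auto
  also have "\<dots> \<le> (\<Sum>x\<in>A \<inter> X. 1)"
    using u_X by (intro sum_mono) auto
  also have "(\<Sum>e | e \<in> F \<and> snd e \<in> B \<inter> Y. u e) =
      (\<Sum>y\<in>B \<inter> Y. \<Sum>e\<in>{e \<in> {e \<in> F. snd e \<in> B \<inter> Y}. snd e = y}. u e)"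
    using finF AB by (intro sum.group[symmetric]) auto
  also have "\<dots> = (\<Sum>y\<in>B \<inter> Y. \<Sum>e | e \<in> F \<and> snd e = y. u e)"
    by (intro sum.cong refl) auto
  also have "\<dots> \<le> (\<Sum>y\<in>B \<inter> Y. 1)"
    using u_Y by (intro sum_mono) auto
  also have "(\<Sum>x\<in>A \<inter> X. 1) + (\<Sum>y\<in>B \<inter> Y. 1) \<le> real (card A + card B)"
    using AB by (simp add: card_mono add_mono)
  finally show ?thesis by simp
qed

text \<open>A maximum matching and a Koenig cover of the same size bound the optimum from both
  sides. The program mentions only the classes, their sizes and \<open>r\<close>, so any two graphs
  that satisfy the hypotheses for the same data have equal matching sizes.\<close>

theorem quotient_lp_optimal_value:
  assumes fin: "finite X" "finite Y" and F: "F \<subseteq> X \<times> Y"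
    and edge: "\<And>p q. p \<in> f ` X \<Longrightarrow> q \<in> g ` Y \<Longrightarrow> r p q \<Longrightarrow> \<exists>(x, y)\<in>F. f x = p \<and> g y = q"
    and rF: "\<And>x y. (x, y) \<in> F \<Longrightarrow> r (f x) (g y)"
    and regX: "\<And>x x' q. x \<in> X \<Longrightarrow> x' \<in> X \<Longrightarrow> f x = f x' \<Longrightarrow>
      card {y. (x, y) \<in> F \<and> g y = q} = card {y. (x', y) \<in> F \<and> g y = q}"
    and regY: "\<And>y y' p. y \<in> Y \<Longrightarrow> y' \<in> Y \<Longrightarrow> g y = g y' \<Longrightarrow>
      card {x. (x, y) \<in> F \<and> f x = p} = card {x. (x, y') \<in> F \<and> f x = p}"
  shows "lp_optimal_value (quotient_lp X Y f g r) (max_matching_size F)"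
proof -
  have finF: "finite F" using F fin by (auto dest: finite_subset)
  obtain M where M: "matching F M" "card M = max_matching_size F"
    using max_matching_size(2)[OF finF] by blast
  obtain A B where AB: "finite A" "finite B" "\<forall>e\<in>F. fst e \<in> A \<or> snd e \<in> B"
    "card A + card B = max_matching_size F"
    using koenig[OF finF] by blast
  show ?thesis
    unfolding lp_optimal_value_def
  proof (intro conjI allI impI)
    show "\<exists>z. lp_feasible (quotient_lp X Y f g r) z \<and>
        lp_value (quotient_lp X Y f g r) z = real (max_matching_size F)"
      unfolding M(2)[symmetric] by (rule quotient_lp_matching[OF fin M(1) F]) (rule rF)
  next
    fix z assume z: "lp_feasible (quotient_lp X Y f g r) z"
    show "lp_value (quotient_lp X Y f g r) z \<le> real (max_matching_size F)"
      unfolding AB(4)[symmetric] by (rule quotient_lp_le_cover[OF fin F _ _ _ _ AB(1-3) z]) (fact edge rF regX regY)+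
  qed
qed

subsection \<open>The random access machine\<close>

text \<open>The generating function, at \<open>Z\<close>, of the subsets with 1 to \<open>w\<close>
  elements of a \<open>k\<close>-element set. Larger subsets cannot occur in a word of weight at
  most \<open>w\<close>, and the cut-off makes the number of terms independent of
  \<open>k\<close>.\<close>

definition block_poly :: "nat \<Rightarrow> nat \<Rightarrow> nat \<Rightarrow> nat" where
  "block_poly w Z k = (\<Sum>t=1..w. (k choose t) * Z ^ t)"

definition runs :: "nat \<Rightarrow> nat \<Rightarrow> program \<Rightarrow> (nat \<Rightarrow> nat) \<Rightarrow> (nat \<Rightarrow> nat) \<Rightarrow> bool" where
  "runs B T p s s' \<longleftrightarrow> (\<exists>t\<le>T. exec B p s t s')"

fun seqs :: "program list \<Rightarrow> program" where
  "seqs [] = Skip"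
| "seqs (p # ps) = Seq p (seqs ps)"

lemma runs_mono: "runs B T p s s' \<Longrightarrow> T \<le> T' \<Longrightarrow> runs B T' p s s'"
  unfolding runs_def using le_trans by blast

lemma runs_1: "exec B p s 1 s' \<Longrightarrow> runs B 1 p s s'"
  unfolding runs_def by blast

lemma runs_Nil: "s = s' \<Longrightarrow> runs B 1 (seqs []) s s'"
  using runs_1[OF exec.Skip] by simp

text \<open>States enter through equations, so that each memory can be rewritten to a normal form
  before the next instruction is treated.\<close>

lemma runs_Cons:
  "runs B T p s0 s' \<Longrightarrow> s = s0 \<Longrightarrow> s1 = s' \<Longrightarrow> runs B U (seqs ps) s1 s'' \<Longrightarrow>
     runs B (T + U) (seqs (p # ps)) s s''"
  unfolding runs_def by (auto intro: exec.Seq add_mono)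

lemmas runs_Call = runs_Cons[OF _ refl]

lemma runs_Const:
  "k \<le> B \<Longrightarrow> s1 = s(a := k) \<Longrightarrow> runs B U (seqs ps) s1 s'' \<Longrightarrow> runs B (1 + U) (seqs (Const a k # ps)) s s''"
  by (rule runs_Cons[OF runs_1 refl], rule exec.Const)

lemma runs_Arith:
  "v = arith f (s b) (s c) \<Longrightarrow> v \<le> B \<Longrightarrow> s1 = s(a := v) \<Longrightarrow> runs B U (seqs ps) s1 s'' \<Longrightarrow>
     runs B (1 + U) (seqs (Arith f a b c # ps)) s s''"
  by (rule runs_Cons[OF runs_1 refl], rule exec.Arith) simp_all

lemma runs_Load:
  "v = s (s b) \<Longrightarrow> v \<le> B \<Longrightarrow> s1 = s(a := v) \<Longrightarrow> runs B U (seqs ps) s1 s'' \<Longrightarrow>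
     runs B (1 + U) (seqs (Load a b # ps)) s s''"
  by (rule runs_Cons[OF runs_1 refl], rule exec.Load) simp_all

lemma runs_Store:
  "v = s b \<Longrightarrow> v \<le> B \<Longrightarrow> s1 = s(s a := v) \<Longrightarrow> runs B U (seqs ps) s1 s'' \<Longrightarrow>
     runs B (1 + U) (seqs (Store a b # ps)) s s''"
  by (rule runs_Cons[OF runs_1 refl], rule exec.Store) simp_all

text \<open>Here \<open>f j\<close> is the memory after \<open>j\<close> rounds: the whole
  trajectory is given explicitly and takes the place of an invariant.\<close>

lemma runs_While:
  assumes "\<And>j. j < N \<Longrightarrow> f j a \<noteq> 0" "f N a = 0"
    and "\<And>j. j < N \<Longrightarrow> runs B T p (f j) (f (Suc j))"
  shows "runs B ((T + 1) * N + 1) (While a p) (f 0) (f N)"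
  using assms
proof (induction N arbitrary: f)
  case 0
  then show ?case by (simp add: runs_1[OF exec.WhileFalse, simplified])
next
  case (Suc N)
  have "runs B ((T + 1) * N + 1) (While a p) (f (Suc 0)) (f (Suc N))"
    using Suc.IH[of "\<lambda>j. f (Suc j)"] Suc.prems by simp
  then obtain u where u: "u \<le> (T + 1) * N + 1" "exec B (While a p) (f (Suc 0)) u (f (Suc N))"
    by (auto simp: runs_def)
  obtain t where t: "t \<le> T" "exec B p (f 0) t (f (Suc 0))"
    using Suc.prems(3)[of 0] by (auto simp: runs_def)
  have "exec B (While a p) (f 0) (t + u + 1) (f (Suc N))"
    using Suc.prems(1)[of 0] t(2) u(2) by (intro exec.WhileTrue) auto
  then show ?case
    using t(1) u(1) unfolding runs_def by (intro exI[of _ "t + u + 1"]) (simp add: algebra_simps)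
qed

text \<open>
  Registers 3 and 4 hold the constants 1 and 0. Subroutines take their arguments in registers 15
  and 16, return their result in register 17, and leave 0 in the scratch registers 18 to 20.
\<close>

definition pow_prog :: program where
  "pow_prog = seqs [Const 17 1, Arith Add 18 16 4,
     While 18 (seqs [Arith Mul 17 17 15, Arith Sub 18 18 3])]"

text \<open>Intermediate powers are bounded through a majorant \<open>y\<close> of the base with
  \<open>1 \<le> y\<close>: for base 0 the final power does not bound the earlier ones.\<close>

lemma runs_pow:
  assumes "s 3 = 1" "s 4 = 0" and N: "s 16 \<le> N" "1 \<le> N" "s 16 \<le> B"
    and y: "s 15 \<le> y" "1 \<le> y" "y ^ s 16 \<le> B"
  shows "runs B (10 * N) pow_prog s (s(17 := s 15 ^ s 16, 18 := 0))"
proof -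
  have bound: "s 15 ^ j \<le> B" if "j \<le> s 16" for j
  proof -
    have "s 15 ^ j \<le> y ^ j" using y(1) by (rule power_mono) simp
    also have "\<dots> \<le> y ^ s 16" using y(2) that by (intro power_increasing) auto
    finally show ?thesis using y(3) by simp
  qed
  have B1: "1 \<le> B" using bound[of 0] by simp
  define f where "f j = s(17 := s 15 ^ j, 18 := s 16 - j)" for j
  have loop: "runs B ((3 + 1) * s 16 + 1) (While 18 (seqs [Arith Mul 17 17 15, Arith Sub 18 18 3])) (f 0) (f (s 16))"
  proof (rule runs_While)
    fix j assume j: "j < s 16"
    have [simp]: "s 15 ^ j * s 15 \<le> B"
      using bound[of "Suc j"] j by (simp add: mult.commute)
    have [simp]: "s 16 - Suc j \<le> B" using N by simp
    show "runs B 3 (seqs [Arith Mul 17 17 15, Arith Sub 18 18 3]) (f j) (f (Suc j))"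
      apply (rule runs_mono)
      apply (rule runs_Arith, (simp add: f_def; fail), simp, (simp; fail))
      apply (rule runs_Arith, (simp add: f_def assms; fail), simp, (simp; fail))
      apply (rule runs_Nil)
      apply (simp_all add: f_def fun_eq_iff mult.commute)
      done
  qed (auto simp: f_def)
  show ?thesis
    unfolding pow_prog_def
    apply (rule runs_mono)
     apply (rule runs_Const[OF B1 refl])
     apply (rule runs_Arith, (simp add: assms; fail), (simp add: N), (simp; fail))
     apply (rule runs_Cons[OF loop])
       apply (simp add: f_def fun_eq_iff)
      apply (rule refl)
     apply (rule runs_Nil)
     apply (simp add: f_def)
    using N by simp
qed

definition binom_prog :: program where
  "binom_prog = seqs [Const 17 1, Const 19 0, Const 20 0, Arith Add 18 16 4,
     While 18 (seqs [Arith Sub 20 15 19, Arith Mul 17 17 20, Arith Add 19 19 3, Arith Div 17 17 19,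
       Arith Sub 18 18 3]),
     Const 19 0, Const 20 0]"

text \<open>The division is exact, since \<open>Suc k * (n choose Suc k)\<close> equals
  \<open>(n - k) * (n choose k)\<close>. For this reason \<open>binom_prog\<close> multiplies before
  it divides.\<close>

lemma binomial_Suc_eq_div: "n choose Suc k = (n choose k) * (n - k) div Suc k"
  by (metis Suc_times_binomial_add binomial_absorb_comp binomial_absorption mult.commute
      nonzero_mult_div_cancel_left nat.distinct(1))

lemma runs_binom:
  assumes "s 3 = 1" "s 4 = 0" and N: "s 16 \<le> N" "1 \<le> N" "s 16 \<le> B"
    and y: "s 15 \<le> y" "1 \<le> y" "y \<le> B" "y ^ s 16 \<le> B"
  shows "runs B (20 * N) binom_prog s (s(17 := s 15 choose s 16, 18 := 0, 19 := 0, 20 := 0))"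
proof -
  have bound: "(s 15 choose j) * (s 15 - j) \<le> B" if "j < s 16" for j
  proof -
    have "(s 15 choose j) * (s 15 - j) \<le> y ^ j * y"
    proof (cases "j \<le> s 15")
      case True
      then have "s 15 choose j \<le> s 15 ^ j" by (rule binomial_le_pow)
      also have "\<dots> \<le> y ^ j" using y(1) by (rule power_mono) simp
      finally show ?thesis using y(1) by (intro mult_mono) auto
    qed (simp add: binomial_eq_0)
    also have "\<dots> = y ^ Suc j" by simp
    also have "\<dots> \<le> y ^ s 16" using y(2) that by (intro power_increasing) auto
    finally show ?thesis using y(4) by simp
  qed
  have B1: "1 \<le> B" and B0: "0 \<le> B" using y by simp_all
  \<comment> \<open>Register 20 keeps the factor of the preceding round, and is still 0 before the
    first one.\<close>
  define f where "f j = s(17 := s 15 choose j, 18 := s 16 - j, 19 := j,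
    20 := if j = 0 then 0 else s 15 - (j - 1))" for j
  let ?body = "seqs [Arith Sub 20 15 19, Arith Mul 17 17 20, Arith Add 19 19 3, Arith Div 17 17 19,
    Arith Sub 18 18 3]"
  have loop: "runs B ((6 + 1) * s 16 + 1) (While 18 ?body) (f 0) (f (s 16))"
  proof (rule runs_While)
    fix j assume j: "j < s 16"
    have [simp]: "s 15 - j \<le> B" using y by simp
    have [simp]: "(s 15 choose j) * (s 15 - j) \<le> B"
      using bound[OF j] .
    have [simp]: "s 16 - Suc j \<le> B" "Suc j \<le> B" using N j by simp_all
    have [simp]: "(s 15 choose Suc j) \<le> B"
      unfolding binomial_Suc_eq_div using bound[OF j] div_le_dividend le_trans by blast
    show "runs B 6 ?body (f j) (f (Suc j))"
      apply (rule runs_mono)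
      apply (rule runs_Arith, (simp add: f_def; fail), simp, (simp; fail))
      apply (rule runs_Arith, (simp add: f_def; fail), simp, (simp; fail))
      apply (rule runs_Arith, (simp add: f_def assms; fail), simp, (simp; fail))
      apply (rule runs_Arith, (simp add: f_def assms flip: binomial_Suc_eq_div; fail), simp, (simp; fail))
      apply (rule runs_Arith, (simp add: f_def assms; fail), simp, (simp; fail))
      apply (rule runs_Nil)
      apply (simp_all add: f_def fun_eq_iff)
      done
  qed (auto simp: f_def)
  show ?thesis
    unfolding binom_prog_def
    apply (rule runs_mono)
     apply (rule runs_Const[OF B1 refl] runs_Const[OF B0 refl])+
     apply (rule runs_Arith, (simp add: assms; fail), (simp add: N), (simp; fail))
     apply (rule runs_Cons[OF loop])
       apply (simp add: f_def fun_eq_iff)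
      apply (rule refl)
     apply (rule runs_Const[OF B0 refl])+
     apply (rule runs_Nil)
     apply (simp add: f_def fun_eq_iff)
    using N by simp
qed


text \<open>Register 30 holds the argument, register 29 the result, and register 21 counts down the degree.\<close>

definition horner_prog :: program where
  "horner_prog = seqs [Const 29 0, Arith Add 21 2 4,
     While 21 (seqs [Arith Add 15 30 4, Arith Add 16 21 4, binom_prog,
       Arith Add 29 29 17, Arith Mul 29 29 9, Arith Sub 21 21 3]),
     Const 15 0, Const 16 0, Const 17 0, Const 18 0, Const 19 0, Const 20 0]"

text \<open>Horner's rule: after \<open>j\<close> rounds the accumulator contains the top
  \<open>j\<close> coefficients, shifted down by \<open>w - j\<close>; for \<open>j = w\<close> it
  is \<open>block_poly\<close>.\<close>

lemma block_poly_Suc: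
  assumes "j < w"
  shows "(\<Sum>t=1..Suc j. (k choose (w - Suc j + t)) * Z ^ t) =
    ((\<Sum>t=1..j. (k choose (w - j + t)) * Z ^ t) + (k choose (w - j))) * Z"
proof -
  have "(\<Sum>t=1..Suc j. (k choose (w - Suc j + t)) * Z ^ t) =
      (\<Sum>t=0..j. (k choose (w - Suc j + Suc t)) * Z ^ Suc t)"
    by (simp only: One_nat_def sum.shift_bounds_cl_Suc_ivl)
  also have "\<dots> = (\<Sum>t=0..j. (k choose (w - j + t)) * Z ^ Suc t)"
    using assms by (intro sum.cong) (auto simp: Suc_diff_Suc)
  also have "\<dots> = (\<Sum>t=1..j. (k choose (w - j + t)) * Z ^ Suc t) + (k choose (w - j)) * Z"
    by (simp add: sum.atLeast_Suc_atMost)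
  also have "\<dots> = ((\<Sum>t=1..j. (k choose (w - j + t)) * Z ^ t) + (k choose (w - j))) * Z"
    by (simp add: algebra_simps sum_distrib_left)
  finally show ?thesis .
qed

text \<open>A Horner round adds a coefficient below \<open>Z\<close>, which enlarges a bound that is
  at least 1 by a factor of at most \<open>Z\<close>, and then multiplies by \<open>Z\<close>. Hence
  two factors per round.\<close>

lemma block_poly_partial_le:
  assumes "\<And>t. t \<le> w \<Longrightarrow> (k choose t) < Z" "j \<le> w"
  shows "(\<Sum>t=1..j. (k choose (w - j + t)) * Z ^ t) \<le> Z ^ (2 * j)"
  using assms(2)
proof (induction j)
  case (Suc j)
  have Z: "1 \<le> Z" using assms(1)[of 0] by simp
  let ?g = "\<Sum>t=1..j. (k choose (w - j + t)) * Z ^ t"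
  have "?g + (k choose (w - j)) \<le> Z ^ (2 * j) * Z"
  proof -
    obtain z where z: "Z = Suc z" using Z by (cases Z) auto
    have "?g + (k choose (w - j)) \<le> Z ^ (2 * j) + z"
      using Suc assms(1)[of "w - j"] z by simp
    also have "\<dots> \<le> Z ^ (2 * j) + Z ^ (2 * j) * z"
      using Z by simp
    also have "\<dots> = Z ^ (2 * j) * Z"
      by (simp add: z)
    finally show ?thesis .
  qed
  then have "(?g + (k choose (w - j))) * Z \<le> Z ^ (2 * j) * Z * Z"
    by (rule mult_right_mono) simp
  then show ?case
    using block_poly_Suc[of j w k Z] Suc.prems by (simp add: mult.commute mult.left_commute del: sum.cl_ivl_Suc)
qed simp

lemma runs_horner:
  assumes s: "s 3 = 1" "s 4 = 0" and N: "s 2 \<le> N" "1 \<le> N" "s 2 \<le> B"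
    and scratch: "s 15 = 0" "s 16 = 0" "s 17 = 0" "s 18 = 0" "s 19 = 0" "s 20 = 0" "s 21 = 0"
    and y: "s 30 \<le> y" "1 \<le> y" "y \<le> B" "y ^ s 2 \<le> B"
    and Z: "\<And>t. t \<le> s 2 \<Longrightarrow> (s 30 choose t) < s 9" "s 9 ^ (2 * s 2) \<le> B"
  shows "runs B (60 * N * N) horner_prog s (s(29 := block_poly (s 2) (s 9) (s 30)))"
proof -
  let ?w = "s 2" and ?Z = "s 9" and ?k = "s 30"
  define g where "g j = (\<Sum>t=1..j. (?k choose (?w - j + t)) * ?Z ^ t)" for j
  have Z1: "1 \<le> ?Z" using Z(1)[of 0] by simp
  have g_Suc: "g (Suc j) = (g j + (?k choose (?w - j))) * ?Z" if "j < ?w" for j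
    using block_poly_Suc[OF that, of ?k ?Z] by (simp add: g_def)
  have g_B: "g j \<le> B" if "j \<le> ?w" for j
  proof -
    have "g j \<le> ?Z ^ (2 * j)"
      unfolding g_def using Z(1) that by (intro block_poly_partial_le)
    also have "\<dots> \<le> ?Z ^ (2 * ?w)" using Z1 that by (intro power_increasing) auto
    finally show ?thesis using Z(2) by simp
  qed
  have B1: "1 \<le> B" and B0: "0 \<le> B" using y by simp_all
  \<comment> \<open>The argument and result registers of \<open>binom_prog\<close> show the call of
    the preceding round; at \<open>j = 0\<close> there is none and they are 0.\<close>
  define f where "f j = s(29 := g j, 21 := ?w - j, 15 := if j = 0 then 0 else ?k,
    16 := if j = 0 then 0 else ?w - (j - 1), 17 := if j = 0 then 0 else ?k choose (?w - (j - 1)))" for j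
  let ?body = "seqs [Arith Add 15 30 4, Arith Add 16 21 4, binom_prog,
       Arith Add 29 29 17, Arith Mul 29 29 9, Arith Sub 21 21 3]"
  have loop: "runs B ((30 * N + 1) * ?w + 1) (While 21 ?body) (f 0) (f ?w)"
  proof (rule runs_While)
    fix j assume j: "j < ?w"
    have [simp]: "?k \<le> B" using y by simp
    have [simp]: "?w - j \<le> B" "?w - Suc j \<le> B" using N by simp_all
    have "g j + (?k choose (?w - j)) \<le> g (Suc j)"
      unfolding g_Suc[OF j] using Z1 by simp
    then have [simp]: "g j + (?k choose (?w - j)) \<le> B"
      using g_B[of "Suc j"] j by simp
    have [simp]: "(g j + (?k choose (?w - j))) * ?Z \<le> B"
      using g_B[of "Suc j"] g_Suc[OF j] j by simp
    have "y ^ (?w - j) \<le> y ^ ?w"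
      using y(2) by (intro power_increasing) auto
    then have [simp]: "y ^ (?w - j) \<le> B"
      using y(4) by simp
    have binom: "runs B (20 * N) binom_prog s' (s'(17 := s' 15 choose s' 16, 18 := 0, 19 := 0, 20 := 0))"
      if "s' = s(29 := g j, 21 := ?w - j, 15 := ?k, 16 := ?w - j,
        17 := if j = 0 then 0 else ?k choose (?w - (j - 1)))" for s'
      by (rule runs_binom[where y = y]) (use that s N y in auto)
    show "runs B (30 * N) ?body (f j) (f (Suc j))"
      apply (rule runs_mono)
      apply (rule runs_Arith, (simp add: f_def s; fail), simp, (simp add: f_def; fail))
      apply (rule runs_Arith, (simp add: f_def s; fail), simp, (simp add: f_def; fail))
      apply (rule runs_Cons[OF binom[OF refl]])
      apply (simp add: fun_eq_iff; fail)
      apply (simp; fail)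
      apply (rule runs_Arith, (simp add: f_def; fail), simp, (simp; fail))
      apply (rule runs_Arith, (simp add: f_def; fail), simp, (simp; fail))
      apply (rule runs_Arith, (simp add: f_def s; fail), simp, (simp; fail))
      apply (rule runs_Nil)
      apply (simp add: f_def fun_eq_iff g_Suc[OF j] scratch)
      using N by simp
  qed (auto simp: f_def)
  have g0: "g 0 = 0" and gw: "g ?w = block_poly ?w ?Z ?k"
    by (simp_all add: g_def block_poly_def)
  \<comment> \<open>Naming the product makes the remaining estimate linear.\<close>
  define q where "q = N * N"
  have "(30 * N + 1) * ?w \<le> (31 * N) * N"
    using N by (intro mult_mono) auto
  then have "(30 * N + 1) * ?w \<le> 31 * q"
    by (simp only: q_def mult.assoc)
  moreover have "1 \<le> q"
    using N by (simp add: q_def)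
  ultimately have time: "(30 * N + 1) * ?w + 20 \<le> 60 * N * N"
    unfolding mult.assoc q_def[symmetric] by linarith
  show ?thesis
    unfolding horner_prog_def
    apply (rule runs_mono)
     apply (rule runs_Const[OF B0 refl])
     apply (rule runs_Arith, (simp add: s; fail), (simp add: N), (simp; fail))
     apply (rule runs_Cons[OF loop])
       apply (simp add: f_def g0 fun_eq_iff scratch)
      apply (rule refl)
     apply (rule runs_Const[OF B0 refl])+
     apply (rule runs_Nil)
     apply (simp add: f_def fun_eq_iff scratch gw)
    using time by simp
qed

text \<open>Memory in a form suited to symbolic execution: 31 registers as a list, on which updates
  evaluate, and from address 31 on the table of the dynamic program.\<close>

definition st :: "nat list \<Rightarrow> (nat \<Rightarrow> nat) \<Rightarrow> nat \<Rightarrow> nat" where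
  "st vs V r = (if r < 31 then vs ! r else V (r - 31))"

lemma st_register: "r < 31 \<Longrightarrow> st vs V r = vs ! r"
  and st_array: "st vs V (31 + i) = V i" "st vs V 31 = V 0"
  by (simp_all add: st_def)

lemma st_upd_register: "r < 31 \<Longrightarrow> length vs = 31 \<Longrightarrow> (st vs V)(r := v) = st (vs[r := v]) V"
  by (auto simp: st_def fun_eq_iff)

lemma st_upd_array: "(st vs V)(31 + i := v) = st vs (V(i := v))"
  by (auto simp: st_def fun_eq_iff)

lemmas st_simps = st_register st_array st_upd_register st_upd_array

text \<open>
  One step of the dynamic program: registers 22 to 28 hold \<open>a choose i\<close>, \<open>G\<^sub>1 ^ i\<close>, the cost of the
  current column at height \<open>h\<close>, the previous entry, \<open>h\<close>, the number of remaining heights, and the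
  address \<open>31 + h\<close> of the entry to be updated. The minimum of \<open>x\<close> and \<open>y\<close> is \<open>x - (x - y)\<close>.
\<close>

definition inner_prog :: program where
  "inner_prog = seqs [
     Load 30 28, Arith Add 30 30 24, Arith Sub 30 25 30, Arith Sub 25 25 30, Store 28 25,
     Arith Add 15 8 4, Arith Add 16 26 4, binom_prog, Arith Mul 29 22 17,
     Arith Add 15 13 4, pow_prog, Arith Mul 17 23 17,
     Arith Div 30 17 10, Arith Mul 30 30 10, Arith Sub 17 17 30,
     Arith Div 30 17 11, Arith Mul 30 30 11, Arith Sub 17 17 30,
     Arith Mul 17 29 17, Arith Sub 24 24 29, Arith Add 24 24 17,
     Arith Add 26 26 3, Arith Add 28 28 3, Arith Sub 27 27 3,
     Const 15 0, Const 16 0, Const 17 0, Const 29 0, Const 30 0]"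

lemma min_eq_diff: "(x :: nat) - (x - y) = min x y"
  by simp

text \<open>The machine has no remainder instruction, so remainders are computed as
  \<open>x - x div z * z\<close>. In the application \<open>L\<close> is the size of a left class at
  height \<open>h\<close> and \<open>x mod Zw mod Z1\<close> is its \<open>fibre_size\<close>, so
  register 24 passes from the column cost at height \<open>h\<close> to the one at
  \<open>Suc h\<close>.\<close>

lemma runs_inner:
  fixes B :: nat
  assumes N: "h \<le> N" "1 \<le> N" "32 + h \<le> B" and B: "b \<le> B" "G0 \<le> B" "e \<le> B" "PR \<le> B" "F \<le> B"
    and y: "b \<le> y" "1 \<le> y" "y \<le> B" "y ^ h \<le> B" and y': "G0 \<le> y'" "1 \<le> y'" "y' ^ h \<le> B"
    and VF: "V h + F \<le> B" and L: "L = CA * (b choose h)" "L \<le> B"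
    and x: "x = GA * G0 ^ h" "x \<le> B" and LR: "L * (x mod Zw mod Z1) \<le> B" "F - L + L * (x mod Zw mod Z1) \<le> B"
  shows "runs B (60 * N) inner_prog
    (st [m,n,w,1,0,d,d1,a,b,Z,Zw,Z1,G1,G0,P,0,0,0,0,0,0,c,CA,GA,F,PR,h,e,31 + h,0,0] V)
    (st [m,n,w,1,0,d,d1,a,b,Z,Zw,Z1,G1,G0,P,0,0,0,0,0,0,c,CA,GA,F - L + L * (x mod Zw mod Z1),
       min PR (V h + F),Suc h,e - 1,31 + Suc h,0,0] (V(h := min PR (V h + F))))"
proof -
  have [simp]: "V h \<le> B" "V h + F \<le> B" using VF by simp_all
  have [simp]: "h \<le> B" "Suc h \<le> B" "31 + h \<le> B" "32 + h \<le> B" "31 + Suc h \<le> B" "e - Suc 0 \<le> B" "min PR (V h + F) \<le> B" "PR - (V h + F) \<le> B"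
    using N B by simp_all
  have [simp]: "G0 ^ h \<le> B"
    using power_mono[OF y'(1), of h] y'(3) by simp
  have [simp]: "CA * (b choose h) = L" "GA * G0 ^ h = x" using L x by simp_all
  have [simp]: "x div Zw \<le> B" "x div Zw * Zw \<le> B" "x mod Zw \<le> B"
    "x mod Zw div Z1 \<le> B" "x mod Zw div Z1 * Z1 \<le> B" "x mod Zw mod Z1 \<le> B"
    using x(2) by (meson div_le_dividend div_times_less_eq_dividend mod_less_eq_dividend le_trans)+
  note [simp] = L(2) x(2) LR B
  have [simp]: "F - L \<le> B" using B(5) by (rule le_trans[OF diff_le_self])
  have binom: "runs B (20 * N) binom_prog s (s(17 := b choose h, 18 := 0, 19 := 0, 20 := 0))"
    if "s 15 = b" "s 16 = h" "s 3 = 1" "s 4 = 0" for s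
    using runs_binom[of s N B y] that N y by simp
  have pow: "runs B (10 * N) pow_prog s (s(17 := G0 ^ h, 18 := 0))"
    if "s 15 = G0" "s 16 = h" "s 3 = 1" "s 4 = 0" for s
    using runs_pow[of s N B y'] that N y' by simp
  show ?thesis
    unfolding inner_prog_def
    apply (rule runs_mono)
     apply (rule runs_Load, (simp add: st_simps; fail), simp, (simp add: st_simps; fail))
     apply (rule runs_Arith, (simp add: st_simps; fail), simp, (simp add: st_simps; fail))
     apply (rule runs_Arith, (simp add: st_simps; fail), simp, (simp add: st_simps; fail))
     apply (rule runs_Arith, (simp add: st_simps min_eq_diff; fail), simp, (simp add: st_simps; fail))
     apply (rule runs_Store, (simp add: st_simps; fail), simp, (simp add: st_simps; fail))
     apply (rule runs_Arith, (simp add: st_simps; fail), simp, (simp add: st_simps; fail))+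
     apply (rule runs_Call, rule binom, (simp add: st_simps; fail)+)
     apply (rule runs_Arith, (simp add: st_simps; fail), simp, (simp add: st_simps; fail))+
     apply (rule runs_Call, rule pow, (simp add: st_simps; fail)+)
     apply (rule runs_Arith, (simp add: st_simps minus_div_mult_eq_mod; fail), simp, (simp add: st_simps; fail))+
     apply (rule runs_Const, simp, (simp add: st_simps; fail))+
     apply (rule runs_Nil)
     apply (simp add: st_simps)
    using N by simp
qed

subsection \<open>Minimum cost staircases\<close>

text \<open>The least cost of nondecreasing heights, all at most \<open>h\<close>, for the first
  \<open>c\<close> columns. Either the last height stays below the bound, or it attains it and
  leaves the earlier columns with the same bound.\<close>

fun stair :: "(nat \<Rightarrow> nat \<Rightarrow> nat) \<Rightarrow> nat \<Rightarrow> nat \<Rightarrow> nat" where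
  "stair F 0 h = 0"
| "stair F (Suc c) 0 = F c 0 + stair F c 0"
| "stair F (Suc c) (Suc h) = min (stair F (Suc c) h) (F c (Suc h) + stair F c (Suc h))"

lemma stair_Suc_le: "k \<le> h \<Longrightarrow> stair F (Suc c) h \<le> F c k + stair F c k"
  by (induction h) (auto simp: le_Suc_eq)

lemma stair_Suc_attained: "\<exists>k\<le>h. stair F (Suc c) h = F c k + stair F c k"
proof (induction h)
  case (Suc h)
  then show ?case
    by (cases "stair F (Suc c) h \<le> F c (Suc h) + stair F c (Suc h)") (auto simp: min_def le_Suc_eq)
qed simp

lemma stair_le_sum:
  assumes "mono k" "\<And>c. c < N \<Longrightarrow> k c \<le> h"
  shows "stair F N h \<le> (\<Sum>c<N. F c (k c))"
  using assms(2)
proof (induction N arbitrary: h)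
  case (Suc N)
  have "stair F (Suc N) h \<le> F N (k N) + stair F N (k N)"
    using Suc.prems by (intro stair_Suc_le) simp
  moreover have "stair F N (k N) \<le> (\<Sum>c<N. F c (k c))"
    using assms(1) by (intro Suc.IH) (simp add: monoD)
  ultimately show ?case by simp
qed simp

lemma stair_attained: "\<exists>k. mono k \<and> (\<forall>c. k c \<le> h) \<and> stair F N h = (\<Sum>c<N. F c (k c))"
proof (induction N arbitrary: h)
  case 0
  show ?case by (intro exI[of _ "\<lambda>_. h"]) (simp add: mono_def)
next
  case (Suc N)
  obtain l where l: "l \<le> h" "stair F (Suc N) h = F N l + stair F N l"
    using stair_Suc_attained by blast
  obtain k where k: "mono k" "\<And>c. k c \<le> l" "stair F N l = (\<Sum>c<N. F c (k c))"
    using Suc by blast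
  \<comment> \<open>Past the last column the height stays at \<open>l\<close>, which makes the
    function monotone on all natural numbers.\<close>
  let ?k = "\<lambda>c. if c < N then k c else l"
  have "mono ?k"
    using k(1,2) by (auto simp: mono_def)
  moreover have "\<forall>c. ?k c \<le> h"
    using k(2) l(1) order_trans by auto
  moreover have "stair F (Suc N) h = (\<Sum>c<Suc N. F c (?k c))"
    using l(2) k(3) by (simp cong: sum.cong_simp)
  ultimately show ?case by blast
qed

section \<open>Block sizes, class sizes and column costs\<close>

locale parameters =
  fixes m n w :: nat
  assumes m_pos: "1 \<le> m" and m_le_n: "m \<le> n" and w_pos: "1 \<le> w"
begin

text \<open>In an equitable graph with these parameters \<open>a\<close> left vertices have degree
  \<open>d + 1\<close> and the other \<open>b\<close> have degree \<open>d\<close>.\<close>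

definition d :: nat where "d = n div m"
definition a :: nat where "a = n mod m"
definition b :: nat where "b = m - a"

lemma a_less: "a < m"
  using m_pos by (simp add: a_def)

text \<open>At most \<open>(n + 1) ^ w\<close> words have weight at most \<open>w\<close>. The
  summand 2 puts all counts of such words strictly below \<open>modulus - 1\<close>, so that
  reduction modulo \<open>modulus - 1\<close> preserves them.\<close>

definition modulus :: nat where "modulus = (n + 1) ^ w + 2"

text \<open>The number of words of weight at most \<open>w\<close> whose support has a prescribed
  neighbour set of profile \<open>(i, j)\<close>, in a form that takes few machine operations; see
  \<open>card_nbrs_fibre\<close>.\<close>

definition fibre_size :: "nat \<Rightarrow> nat \<Rightarrow> nat" where
  "fibre_size i j = block_poly w modulus (d + 1) ^ i * block_poly w modulus d ^ j
     mod modulus ^ Suc w mod (modulus - 1)"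

text \<open>The share of the profiles with first component \<open>i\<close> in the cover given by a
  staircase of height \<open>k\<close> there: the classes below the staircase are paid for on the
  right side, the others on the left.\<close>

definition column_cost :: "nat \<Rightarrow> nat \<Rightarrow> nat" where
  "column_cost i k = (\<Sum>j<k. (a choose i) * (b choose j) * fibre_size i j) +
     (\<Sum>j=k..b. (a choose i) * (b choose j))"

end

section \<open>The complete program and its resource bounds\<close>

definition outer_prog :: program where
  "outer_prog = seqs [
     Arith Sub 16 21 3, Arith Add 15 7 4, binom_prog, Arith Add 22 17 4,
     Arith Add 15 12 4, pow_prog, Arith Add 23 17 4, Arith Mul 24 22 14,
     Const 28 31, Load 25 28, Arith Add 25 25 24, Arith Add 27 8 3, Arith Add 27 27 3,
     Const 15 0, Const 16 0, Const 17 0, While 27 inner_prog, Arith Sub 21 21 3,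
     Const 22 0, Const 23 0, Const 24 0, Const 26 0, Const 28 0]"

definition setup_prog :: program where
  "setup_prog = seqs [
     Const 3 1, Arith Div 5 1 0, Arith Add 6 5 3, Arith Mul 7 5 0, Arith Sub 7 1 7, Arith Sub 8 0 7,
     Arith Add 15 1 3, Arith Add 16 2 4, pow_prog, Arith Add 9 17 3, Arith Add 9 9 3,
     Arith Add 15 9 4, Arith Add 16 2 3, pow_prog, Arith Add 10 17 4, Arith Sub 11 9 3,
     Const 15 2, Arith Add 16 8 4, pow_prog, Arith Add 14 17 4, Const 15 0, Const 16 0, Const 17 0,
     Arith Add 30 6 4, horner_prog, Arith Add 12 29 4, Arith Add 30 5 4, horner_prog, Arith Add 13 29 4,
     Const 29 0, Const 30 0, Arith Add 21 7 3]"

text \<open>Truncated subtraction replaces a test: \<open>1 - (2 ^ m - v)\<close> is 1 if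
  \<open>2 ^ m \<le> v\<close> and 0 otherwise.\<close>

definition main_prog :: program where
  "main_prog = seqs [setup_prog, While 21 outer_prog, Const 15 2, Arith Add 16 0 4, pow_prog,
     Arith Sub 17 17 25, Arith Sub 0 3 17, Arith Add 1 25 4]"

context parameters
begin

text \<open>A column cost has at most \<open>m + 2\<close> summands on the right and
  \<open>m + 1\<close> on the left, each at most \<open>2 ^ m * modulus\<close>.\<close>

definition cost_bound :: nat where
  "cost_bound = (2 * m + 3) * (2 ^ m * modulus)"

text \<open>The four kinds of numbers in a run: addresses and counters, powers of
  \<open>n + 2\<close> that bound binomials, products of at most \<open>2 * (m + w + 2)\<close>
  values of \<open>block_poly\<close>, and sums of column costs.\<close>

definition ample :: "nat \<Rightarrow> bool" where
  "ample B \<longleftrightarrow> n + m + w + 40 \<le> B \<and> (n + 2) ^ (m + w + 2) \<le> B \<and>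
     modulus ^ (2 * w * (2 * (m + w + 2))) \<le> B \<and> (m + 2) * cost_bound \<le> B"

lemma b_le: "b \<le> m" and a_add_b: "a + b = m"
  using a_less by (simp_all add: b_def)

lemma d_le: "d \<le> n"
  by (simp add: d_def)

lemma binomial_product_le: "(a choose i) * (b choose j) \<le> 2 ^ m"
proof -
  have "(a choose i) * (b choose j) \<le> 2 ^ a * 2 ^ b"
    by (intro mult_le_mono binomial_le_pow2)
  then show ?thesis by (simp add: a_add_b flip: power_add)
qed

lemma binomial_less_modulus: "k \<le> n + 1 \<Longrightarrow> t \<le> w \<Longrightarrow> k choose t < modulus"
proof -
  assume k: "k \<le> n + 1" and t: "t \<le> w"
  have "k choose t \<le> k ^ t"
    by (cases "t \<le> k") (auto simp: binomial_le_pow binomial_eq_0)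
  also have "\<dots> \<le> (n + 1) ^ t" using k by (rule power_mono) simp
  also have "\<dots> \<le> (n + 1) ^ w" using t by (intro power_increasing) auto
  finally show ?thesis by (simp add: modulus_def)
qed

lemma block_poly_le: "k \<le> n + 1 \<Longrightarrow> block_poly w modulus k \<le> modulus ^ (2 * w)"
  using block_poly_partial_le[of w k modulus w] binomial_less_modulus by (simp add: block_poly_def)

lemma fibre_size_less: "fibre_size i j < modulus"
proof -
  have "fibre_size i j < modulus - 1"
    unfolding fibre_size_def by (rule mod_less_divisor) (simp add: modulus_def)
  then show ?thesis by simp
qed

lemma column_cost_0: "column_cost i 0 = (a choose i) * 2 ^ b"
  by (simp add: column_cost_def atLeast0AtMost choose_row_sum flip: sum_distrib_left)

text \<open>Raising the staircase by one moves the class \<open>(i, k)\<close> from the left part of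
  the cover to the right part. For \<open>k > b\<close> this class is empty, and the subtraction
  removes 0.\<close>

lemma column_cost_Suc:
  "column_cost i (Suc k) = column_cost i k - (a choose i) * (b choose k) + (a choose i) * (b choose k) * fibre_size i k"
proof (cases "k \<le> b")
  case True
  then have "(\<Sum>j=k..b. (a choose i) * (b choose j)) =
      (a choose i) * (b choose k) + (\<Sum>j=Suc k..b. (a choose i) * (b choose j))"
    by (simp add: sum.atLeast_Suc_atMost)
  then show ?thesis by (simp add: column_cost_def)
qed (simp add: column_cost_def binomial_eq_0)

text \<open>The range reaches \<open>b + 2\<close> because the last inner round, at height
  \<open>b + 1\<close>, still advances the cost register.\<close>

lemma column_cost_le: "k \<le> b + 2 \<Longrightarrow> column_cost i k \<le> cost_bound"
proof -
  assume k: "k \<le> b + 2"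
  have "(\<Sum>j<k. (a choose i) * (b choose j) * fibre_size i j) \<le> of_nat (card {..<k}) * (2 ^ m * modulus)"
    by (intro sum_bounded_above mult_le_mono[OF binomial_product_le less_imp_le[OF fibre_size_less]])
  moreover have "(\<Sum>j=k..b. (a choose i) * (b choose j)) \<le> of_nat (card {k..b}) * (2 ^ m * modulus)"
  proof (intro sum_bounded_above)
    fix j
    have "(a choose i) * (b choose j) * 1 \<le> 2 ^ m * modulus"
      using binomial_product_le by (intro mult_le_mono) (auto simp: modulus_def)
    then show "(a choose i) * (b choose j) \<le> 2 ^ m * modulus" by simp
  qed
  ultimately have "column_cost i k \<le> (k + (Suc b - k)) * (2 ^ m * modulus)"
    by (simp add: column_cost_def add_mult_distrib)
  also have "\<dots> \<le> cost_bound"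
    unfolding cost_bound_def using k b_le by (intro mult_right_mono) auto
  finally show ?thesis .
qed

text \<open>Columns are taken in order of decreasing first component: the heights of a down-set then
  increase, as \<open>stair\<close> demands.\<close>

abbreviation cost :: "nat \<Rightarrow> nat \<Rightarrow> nat" where
  "cost \<equiv> \<lambda>c. column_cost (a - c)"

lemma stair_le: "h \<le> b + 2 \<Longrightarrow> stair cost c h \<le> c * cost_bound"
proof (induction c)
  case (Suc c)
  have "stair cost (Suc c) h \<le> cost c h + stair cost c h"
    by (rule stair_Suc_le) simp
  then show ?case
    using Suc column_cost_le[OF Suc.prems, of "a - c"] by simp
qed simp

lemma
  assumes "ample B"
  shows ample_small: "k \<le> n + m + w + 40 \<Longrightarrow> k \<le> B"
    and ample_pow: "k \<le> m + w + 2 \<Longrightarrow> (n + 2) ^ k \<le> B"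
    and ample_modulus: "k \<le> 2 * w * (2 * (m + w + 2)) \<Longrightarrow> modulus ^ k \<le> B"
    and ample_cost: "k \<le> m + 2 \<Longrightarrow> k * cost_bound \<le> B"
proof -
  show "k \<le> n + m + w + 40 \<Longrightarrow> k \<le> B"
    using assms by (simp add: ample_def)
  show "(n + 2) ^ k \<le> B" if "k \<le> m + w + 2"
    using assms power_increasing[OF that, of "n + 2"] unfolding ample_def by linarith
  show "modulus ^ k \<le> B" if "k \<le> 2 * w * (2 * (m + w + 2))"
  proof -
    have "modulus ^ k \<le> modulus ^ (2 * w * (2 * (m + w + 2)))"
      using that by (rule power_increasing) (simp add: modulus_def)
    then show ?thesis using assms unfolding ample_def by linarith
  qed
  show "k * cost_bound \<le> B" if "k \<le> m + 2"
    using assms mult_right_mono[OF that, of cost_bound] unfolding ample_def by simp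
qed

definition frame :: "nat list \<Rightarrow> (nat \<Rightarrow> nat) \<Rightarrow> nat \<Rightarrow> nat" where
  "frame live V = st ([m,n,w,1,0,d,d + 1,a,b,modulus,modulus ^ Suc w,modulus - 1,
     block_poly w modulus (d + 1),block_poly w modulus d,2 ^ b,0,0,0,0,0,0] @ live) V"

text \<open>The table after \<open>c\<close> columns. All entries of \<open>row 0\<close> vanish, so
  the untouched memory is already the correct initial table.\<close>

definition row :: "nat \<Rightarrow> nat \<Rightarrow> nat" where
  "row c g = (if g \<le> Suc b then stair cost c g else 0)"

lemma runs_outer:
  assumes B: "ample B" and c: "c \<le> a" and N: "N = m + w + 2"
  shows "runs B (200 * N * N) outer_prog
    (frame [Suc a - c,0,0,0,stair cost c (Suc b),0,0,0,0,0] (row c))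
    (frame [Suc a - Suc c,0,0,0,stair cost (Suc c) (Suc b),0,0,0,0,0] (row (Suc c)))"
proof -
  let ?i = "a - c"
  let ?CA = "a choose ?i" and ?G1 = "block_poly w modulus (d + 1)" and ?G0 = "block_poly w modulus d"
  let ?Y = "modulus ^ (2 * w)"
  \<comment> \<open>The table is updated in place: the new entry at \<open>h\<close> needs only the
    old entry at \<open>h\<close> and the new one at \<open>h - 1\<close>, which is kept in a
    register.\<close>
  define W where "W h g = (if g < h then stair cost (Suc c) g else row c g)" for h g
  \<comment> \<open>At \<open>h = 0\<close> truncation makes \<open>h - 1\<close> equal to 0: the
    register is preloaded with the new entry 0, so that taking the minimum in the first round
    changes nothing.\<close>
  define f where "f h = frame [Suc a - c,?CA,?G1 ^ ?i,column_cost ?i h,stair cost (Suc c) (h - 1),h,b + 2 - h,31 + h,0,0] (W h)" for h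
  have Y1: "1 \<le> ?Y" by (simp add: modulus_def)
  have Ypow: "?Y ^ k \<le> B" if "k \<le> 2 * (m + w + 2)" for k
    unfolding power_mult[symmetric] by (rule ample_modulus[OF B mult_le_mono2[OF that]])
  have G1: "?G1 \<le> ?Y" and G0: "?G0 \<le> ?Y"
    using d_le by (simp_all add: block_poly_le)
  note small = ample_small[OF B]
  have stair_B: "stair cost k h \<le> B" if "k \<le> m + 2" "h \<le> b + 2" for k h
    using stair_le[OF that(2)] ample_cost[OF B that(1)] le_trans by blast
  have cost_B: "column_cost i h \<le> B" if "h \<le> b + 2" for i h
    using column_cost_le[OF that, of i] ample_cost[OF B, of 1] by simp
  have sum_B: "stair cost c h + column_cost i h \<le> B" if "h \<le> b + 2" for i h
  proof -
    have "stair cost c h + column_cost i h \<le> c * cost_bound + cost_bound"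
      using stair_le[OF that] column_cost_le[OF that] by (rule add_mono)
    also have "\<dots> = Suc c * cost_bound" by simp
    also have "\<dots> \<le> B" using c a_less by (intro ample_cost[OF B]) simp
    finally show ?thesis .
  qed
  have inner: "runs B (60 * N) inner_prog (f h) (f (Suc h))" if h: "h < b + 2" for h
  proof -
    let ?L = "?CA * (b choose h)" and ?x = "?G1 ^ ?i * ?G0 ^ h"
    have fib: "?x mod modulus ^ Suc w mod (modulus - 1) = fibre_size ?i h"
      by (simp add: fibre_size_def)
    have Wh: "W h h = stair cost c h"
      using h by (simp add: W_def row_def)
    have next_min: "min (stair cost (Suc c) (h - 1)) (W h h + column_cost ?i h) = stair cost (Suc c) h"
      unfolding Wh by (cases h) (simp_all add: add.commute)
    have W_Suc: "(W h)(h := stair cost (Suc c) h) = W (Suc h)"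
      by (auto simp: W_def fun_eq_iff less_Suc_eq)
    have cost_Suc: "column_cost ?i (Suc h) = column_cost ?i h - ?L + ?L * (?x mod modulus ^ Suc w mod (modulus - 1))"
      unfolding fib by (rule column_cost_Suc)
    have "runs B (60 * N) inner_prog
      (st [m,n,w,1,0,d,d + 1,a,b,modulus,modulus ^ Suc w,modulus - 1,?G1,?G0,2 ^ b,0,0,0,0,0,0,Suc a - c,?CA,
        ?G1 ^ ?i,column_cost ?i h,stair cost (Suc c) (h - 1),h,b + 2 - h,31 + h,0,0] (W h))
      (st [m,n,w,1,0,d,d + 1,a,b,modulus,modulus ^ Suc w,modulus - 1,?G1,?G0,2 ^ b,0,0,0,0,0,0,Suc a - c,?CA,
        ?G1 ^ ?i,column_cost ?i h - ?L + ?L * (?x mod modulus ^ Suc w mod (modulus - 1)),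
        min (stair cost (Suc c) (h - 1)) (W h h + column_cost ?i h),Suc h,b + 2 - h - 1,31 + Suc h,0,0]
        ((W h)(h := min (stair cost (Suc c) (h - 1)) (W h h + column_cost ?i h))))"
    proof (rule runs_inner[where y = "n + 2" and y' = "?Y"])
      show "h \<le> N" "1 \<le> N" using h N b_le by auto
      show "32 + h \<le> B" "b \<le> B" "b + 2 - h \<le> B" "n + 2 \<le> B"
        using h b_le by (auto intro!: small)
      show "?G0 \<le> B" using G0 Ypow[of 1] by simp
      show "stair cost (Suc c) (h - 1) \<le> B"
        using c a_less h by (intro stair_B) auto
      show "column_cost ?i h \<le> B" using h by (intro cost_B) simp
      show "b \<le> n + 2" "1 \<le> n + 2" using b_le m_le_n by auto
      show "(n + 2) ^ h \<le> B" using h b_le by (intro ample_pow[OF B]) simp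
      show "?G0 \<le> ?Y" "1 \<le> ?Y" by (fact G0 Y1)+
      show "?Y ^ h \<le> B" using h b_le by (intro Ypow) simp
      show "W h h + column_cost ?i h \<le> B"
        unfolding Wh using h by (intro sum_B) simp
      have "?L \<le> 2 ^ m" by (rule binomial_product_le)
      also have "2 ^ m \<le> (n + 2) ^ m" by (rule power_mono) auto
      also have "\<dots> \<le> B" by (rule ample_pow[OF B]) simp
      finally show "?L \<le> B" .
      have "?x \<le> ?Y ^ ?i * ?Y ^ h"
        using G1 G0 by (intro mult_le_mono power_mono) auto
      also have "\<dots> = ?Y ^ (?i + h)" by (simp add: power_add)
      also have "\<dots> \<le> B" using h b_le a_less by (intro Ypow) simp
      finally show "?x \<le> B" .
      have "?L * fibre_size ?i h \<le> column_cost ?i (Suc h)"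
        unfolding column_cost_Suc by simp
      also have "\<dots> \<le> B" using h by (intro cost_B) simp
      finally show "?L * (?x mod modulus ^ Suc w mod (modulus - 1)) \<le> B"
        unfolding fib .
      show "column_cost ?i h - ?L + ?L * (?x mod modulus ^ Suc w mod (modulus - 1)) \<le> B"
        unfolding cost_Suc[symmetric] using h by (intro cost_B) simp
    qed (rule refl)+
    then show ?thesis
      unfolding next_min W_Suc cost_Suc[symmetric] by (simp add: f_def frame_def)
  qed
  \<comment> \<open>The \<open>b + 2\<close> rounds are the heights 0 to \<open>b + 1\<close>; the
    top height puts the whole column below the staircase.\<close>
  have loop: "runs B ((60 * N + 1) * (b + 2) + 1) (While 27 inner_prog) (f 0) (f (b + 2))"
  proof (rule runs_While)
    show "runs B (60 * N) inner_prog (f h) (f (Suc h))" if "h < b + 2" for h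
      using that by (rule inner)
  qed (auto simp: f_def frame_def st_register)
  have W0: "W 0 = row c"
    by (simp add: W_def fun_eq_iff)
  have Wb: "W (b + 2) = row (Suc c)"
    by (auto simp: W_def row_def fun_eq_iff)
  have row0: "row c 0 = stair cost c 0"
    by (simp add: row_def)
  have c_le: "c \<le> m + 2"
    using c a_less by simp
  have [simp]: "Suc a - c - Suc 0 = a - c" "c \<le> a" "Suc a - c = Suc (a - c)" "b + 2 = Suc (Suc b)"
    using c by simp_all
  have [simp]: "a \<le> B" "a - c \<le> B" "b \<le> B" "Suc b \<le> B" "Suc (Suc b) \<le> B" "31 \<le> B" "0 \<le> B"
    using b_le a_less by (auto intro!: small)
  have "?CA * 2 ^ b \<le> B"
    using cost_B[of 0 ?i] by (simp only: column_cost_0)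
  moreover have "?CA \<le> ?CA * 2 ^ b" by simp
  ultimately have [simp]: "?CA * 2 ^ b \<le> B" "?CA \<le> B"
    by (simp_all only: le_trans)
  have "?G1 ^ ?i \<le> ?Y ^ ?i" using G1 by (rule power_mono) simp
  also have "\<dots> \<le> B" using a_less by (intro Ypow) simp
  finally have [simp]: "block_poly w modulus (Suc d) ^ (a - c) \<le> B" by simp
  have [simp]: "block_poly w modulus (Suc d) \<le> B" using G1 Ypow[of 1] by simp
  have [simp]: "stair cost c 0 \<le> B" using c_le by (intro stair_B) auto
  have [simp]: "stair cost c 0 + ?CA * 2 ^ b \<le> B"
    using sum_B[of 0 ?i] by (simp only: column_cost_0)
  have binom: "runs B (20 * N) binom_prog s (s(17 := ?CA, 18 := 0, 19 := 0, 20 := 0))"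
    if "s 15 = a" "s 16 = a - c" "s 3 = 1" "s 4 = 0" for s
  proof -
    have "(n + 2) ^ (a - c) \<le> B" using a_less by (intro ample_pow[OF B]) simp
    then show ?thesis
      using runs_binom[of s N B "n + 2"] that N a_less m_le_n small[of "n + 2"] by simp
  qed
  have pow: "runs B (10 * N) pow_prog s (s(17 := ?G1 ^ ?i, 18 := 0))"
    if "s 15 = ?G1" "s 16 = a - c" "s 3 = 1" "s 4 = 0" for s
  proof -
    have "?Y ^ (a - c) \<le> B" using a_less by (intro Ypow) simp
    then show ?thesis
      using runs_pow[of s N B ?Y] that N a_less G1 Y1 by simp
  qed
  define q where "q = N * N"
  have "(60 * N + 1) * (b + 2) \<le> 61 * N * N"
    using N b_le by (intro mult_mono) auto
  then have loop_time: "(60 * N + 1) * (b + 2) \<le> 61 * q"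
    by (simp only: q_def mult.assoc)
  have N_q: "N \<le> q" "1 \<le> N" by (simp_all add: q_def N)
  note sim = st_simps row0 column_cost_0
  show ?thesis
    unfolding frame_def append.simps outer_prog_def
    apply (rule runs_mono)
     apply (rule runs_Arith, (simp add: sim; fail), simp, (simp add: sim; fail))+
     apply (rule runs_Call, rule binom, (simp add: sim; fail)+)
     apply (rule runs_Arith, (simp add: sim; fail), simp, (simp add: sim; fail))+
     apply (rule runs_Call, rule pow, (simp add: sim; fail)+)
     apply (rule runs_Arith, (simp add: sim; fail), simp, (simp add: sim; fail))+
     apply (rule runs_Const, simp, (simp add: sim; fail))
     apply (rule runs_Load, (simp add: sim; fail), simp, (simp add: sim; fail))
     apply (rule runs_Arith, (simp add: sim; fail), simp, (simp add: sim; fail))+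
     apply (rule runs_Const, simp, (simp add: sim; fail))+
     apply (rule runs_Cons[OF loop])
       apply (simp add: f_def frame_def W0 column_cost_0 add.commute[of "stair cost c 0"])
      apply (rule refl)
     apply (rule runs_Arith, (simp add: f_def frame_def sim; fail), simp, (simp add: f_def frame_def sim; fail))
     apply (rule runs_Const, simp, (simp add: sim; fail))+
     apply (rule runs_Nil)
     apply (simp add: sim Wb[simplified])
    using loop_time N_q unfolding mult.assoc q_def[symmetric] by linarith
qed

end

lemma input_memory_eq:
  "input_memory m n w = st [m,n,w,0,0,0,0,0,0,0,0,0,0,0,0,0,0,0,0,0,0,0,0,0,0,0,0,0,0,0,0] (\<lambda>_. 0)"
proof -
  have "(\<lambda>_. 0) = st (replicate 31 0) (\<lambda>_. 0)"
    by (simp add: st_def fun_eq_iff)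
  also have "replicate 31 (0 :: nat) = [0,0,0,0,0,0,0,0,0,0,0,0,0,0,0,0,0,0,0,0,0,0,0,0,0,0,0,0,0,0,0]"
    by (simp add: numeral_eq_Suc)
  finally have "input_memory m n w =
      (st [0,0,0,0,0,0,0,0,0,0,0,0,0,0,0,0,0,0,0,0,0,0,0,0,0,0,0,0,0,0,0] (\<lambda>_. 0))(0 := m, 1 := n, 2 := w)"
    by (simp only: input_memory_def)
  then show ?thesis
    by (simp add: st_upd_register)
qed

context parameters
begin

lemma runs_setup:
  assumes B: "ample B" and N: "N = m + w + 2"
  shows "runs B (200 * N * N) setup_prog (input_memory m n w) (frame [Suc a,0,0,0,0,0,0,0,0,0] (\<lambda>_. 0))"
proof -
  note small = ample_small[OF B]
  have N_le [simp]: "w \<le> N" "Suc w \<le> N" "b \<le> N" "Suc 0 \<le> N"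
    using b_le by (simp_all add: N)
  have dm: "d * m \<le> n" by (simp add: d_def)
  have mod_ge: "Suc (Suc n ^ w) \<le> modulus" by (simp add: modulus_def)
  have [simp]: "n div m = d" "n - d * m = a" "m - a = b" "Suc (Suc (Suc n ^ w)) = modulus" "0 < modulus"
    by (simp_all add: d_def a_def b_def modulus_def minus_div_mult_eq_mod)
  have [simp]: "m \<le> B" "n \<le> B" "w \<le> B" "Suc w \<le> B" "d \<le> B" "Suc d \<le> B" "a \<le> B" "Suc a \<le> B" "b \<le> B"
    "Suc n \<le> B" "Suc (Suc n) \<le> B" "0 \<le> B" "Suc 0 \<le> B" "2 \<le> B"
    using b_le a_less d_le by (auto intro!: small)
  from dm have [simp]: "d * m \<le> B" by (rule le_trans) simp
  have pow_B: "Suc (Suc n) ^ k \<le> B" if "k \<le> m + w + 2" for k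
    using ample_pow[OF B that] by (simp only: add_2_eq_Suc')
  have [simp]: "Suc (Suc n) ^ w \<le> B" "Suc (Suc n) ^ b \<le> B"
    by (rule pow_B; use b_le in linarith)+
  have "Suc n ^ w \<le> Suc (Suc n) ^ w" by (rule power_mono) simp_all
  then have [simp]: "Suc n ^ w \<le> B" by (rule le_trans) simp
  have mod_B: "modulus ^ k \<le> B" if "k \<le> 2 * w * (m + w + 2)" for k
  proof (rule ample_modulus[OF B])
    have "2 * w * (m + w + 2) \<le> 2 * w * (2 * (m + w + 2))" by (rule mult_le_mono2) simp
    with that show "k \<le> 2 * w * (2 * (m + w + 2))" by (rule le_trans)
  qed
  have "2 * w * 1 \<le> 2 * w * (m + w + 2)" by (rule mult_le_mono2) simp
  then have "2 * w \<le> 2 * w * (m + w + 2)" "Suc w \<le> 2 * w * (m + w + 2)" "1 \<le> 2 * w * (m + w + 2)"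
    using w_pos by linarith+
  from mod_B[OF this(1)] mod_B[OF this(2)] mod_B[OF this(3)]
  have [simp]: "modulus ^ (2 * w) \<le> B" "modulus * modulus ^ w \<le> B" "modulus \<le> B"
    by simp_all
  from mod_ge have [simp]: "Suc (Suc n ^ w) \<le> B" by (rule le_trans) simp
  from mod_ge have [simp]: "Suc 0 \<le> modulus" by linarith
  have [simp]: "modulus - Suc 0 \<le> B" by (rule le_trans[OF diff_le_self]) simp
  have "2 ^ b \<le> Suc (Suc n) ^ b" by (rule power_mono) simp_all
  then have [simp]: "2 ^ b \<le> B" by (rule le_trans) simp
  have [simp]: "block_poly w modulus d \<le> B" "block_poly w modulus (Suc d) \<le> B"
    by (rule le_trans[OF block_poly_le]; use d_le in simp)+
  have choose: "k choose t < modulus" if "k \<le> Suc d" "t \<le> w" for k t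
    using that d_le by (intro binomial_less_modulus) auto
  have q: "N \<le> N * N" "1 \<le> N" by (simp_all add: N)
  note sim = st_simps choose
  show ?thesis
    unfolding frame_def append.simps setup_prog_def input_memory_eq
    apply (rule runs_mono)
     apply (rule runs_Const, simp, (simp add: sim; fail))
     apply (rule runs_Arith, (simp add: sim; fail), simp, (simp add: sim; fail))+
     apply (rule runs_Call, rule runs_pow[where N = N and y = "n + 2"], (simp add: sim; fail)+)
     apply (rule runs_Arith, (simp add: sim; fail), simp, (simp add: sim; fail))+
     apply (rule runs_Call, rule runs_pow[where N = N and y = modulus], (simp add: sim; fail)+)
     apply (rule runs_Arith, (simp add: sim; fail), simp, (simp add: sim; fail))+
     apply (rule runs_Const, simp, (simp add: sim; fail))
     apply (rule runs_Arith, (simp add: sim; fail), simp, (simp add: sim; fail))+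
     apply (rule runs_Call, rule runs_pow[where N = N and y = "n + 2"], (simp add: sim; fail)+)
     apply (rule runs_Arith, (simp add: sim; fail), simp, (simp add: sim; fail))+
     apply (rule runs_Const, simp, (simp add: sim; fail))+
     apply (rule runs_Arith, (simp add: sim; fail), simp, (simp add: sim; fail))+
     apply (rule runs_Call, rule runs_horner[where N = N and y = "n + 2"], (use d_le in \<open>simp add: sim\<close>; fail)+)
     apply (rule runs_Arith, (simp add: sim; fail), simp, (simp add: sim; fail))+
     apply (rule runs_Call, rule runs_horner[where N = N and y = "n + 2"], (use d_le in \<open>simp add: sim\<close>; fail)+)
     apply (rule runs_Arith, (simp add: sim; fail), simp, (simp add: sim; fail))+
     apply (rule runs_Const, simp, (simp add: sim; fail))+
     apply (rule runs_Arith, (simp add: sim; fail), simp, (simp add: sim; fail))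
     apply (rule runs_Nil)
     apply (simp add: sim)
    using q unfolding mult.assoc by linarith
qed

text \<open>There are \<open>Suc a \<le> N\<close> columns of \<open>200 * N * N\<close> steps each;
  setup and final comparison fit into what remains of \<open>1000 * N ^ 3\<close>.\<close>

lemma runs_main:
  assumes B: "ample B" and N: "N = m + w + 2"
  defines "\<nu> \<equiv> stair cost (Suc a) (Suc b)"
  shows "\<exists>s. runs B (1000 * N ^ 3) main_prog (input_memory m n w) s \<and> s 0 = 1 - (2 ^ m - \<nu>) \<and> s 1 = \<nu>"
proof -
  define f where "f c = frame [Suc a - c,0,0,0,stair cost c (Suc b),0,0,0,0,0] (row c)" for c
  have loop: "runs B ((200 * N * N + 1) * Suc a + 1) (While 21 outer_prog) (f 0) (f (Suc a))"
  proof (rule runs_While)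
    show "runs B (200 * N * N) outer_prog (f c) (f (Suc c))" if "c < Suc a" for c
      unfolding f_def using runs_outer[OF B _ N] that by simp
  qed (auto simp: f_def frame_def st_register)
  have row0: "row 0 = (\<lambda>_. 0)"
    by (simp add: row_def fun_eq_iff)
  have [simp]: "m \<le> B" "0 \<le> B" "2 \<le> B" "Suc 0 \<le> B" by (auto intro!: ample_small[OF B])
  have m2: "Suc (Suc n) ^ m \<le> B" using ample_pow[OF B, of m] by simp
  moreover have "2 ^ m \<le> Suc (Suc n) ^ m" by (rule power_mono) simp_all
  ultimately have [simp]: "2 ^ m \<le> B" "Suc (Suc n) ^ m \<le> B" by simp_all
  have "\<nu> \<le> Suc a * cost_bound"
    unfolding \<nu>_def by (rule stair_le) simp
  also have "\<dots> \<le> B" using a_less by (intro ample_cost[OF B]) simp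
  finally have [simp]: "\<nu> \<le> B" .
  have [simp]: "2 ^ m - \<nu> \<le> B" "Suc 0 - (2 ^ m - \<nu>) \<le> B"
    by (rule le_trans[OF diff_le_self]; simp)+
  have [simp]: "m \<le> N" "Suc 0 \<le> N" by (simp_all add: N)
  have pow: "runs B (10 * N) pow_prog s (s(17 := 2 ^ m, 18 := 0))"
    if "s 15 = 2" "s 16 = m" "s 3 = 1" "s 4 = 0" for s
    using runs_pow[of s N B "n + 2"] that by simp
  define q where "q = N * N * N"
  have NN: "1 \<le> N * N" by (simp add: N)
  then have "200 * N * N + 1 \<le> 201 * (N * N)"
    unfolding mult.assoc by linarith
  moreover have "Suc a \<le> N" using a_less by (simp add: N)
  ultimately have "(200 * N * N + 1) * Suc a \<le> 201 * (N * N) * N"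
    by (rule mult_le_mono)
  then have t1: "(200 * N * N + 1) * Suc a \<le> 201 * q"
    by (simp only: q_def mult.assoc)
  have t2: "N \<le> q" "1 \<le> q" by (simp_all add: q_def N)
  have "N * N * 1 \<le> N * N * N" by (rule mult_le_mono2) (simp add: N)
  then have t3: "200 * N * N \<le> 200 * q" by (simp add: q_def)
  have cube: "N ^ 3 = q" by (simp add: q_def power3_eq_cube)
  have fin: "f (Suc a) = st [m,n,w,1,0,d,d + 1,a,b,modulus,modulus ^ Suc w,modulus - 1,
      block_poly w modulus (d + 1),block_poly w modulus d,2 ^ b,0,0,0,0,0,0,0,0,0,0,\<nu>,0,0,0,0,0] (row (Suc a))"
    unfolding f_def frame_def \<nu>_def by (simp del: stair.simps)
  have "\<exists>s. runs B (1000 * N ^ 3) main_prog (input_memory m n w) s \<and> s = (f (Suc a))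
      (15 := 2, 16 := m, 17 := 2 ^ m - \<nu>, 18 := 0, 0 := 1 - (2 ^ m - \<nu>), 1 := \<nu>)"
    unfolding main_prog_def fin
    apply (intro exI conjI)
     apply (rule runs_mono)
      apply (rule runs_Call, rule runs_setup[OF B N], rule refl)
      apply (rule runs_Cons[OF loop])
        apply (simp add: f_def row0)
       apply (rule fin[symmetric])
      apply (rule runs_Const, simp, (simp add: st_simps; fail))
      apply (rule runs_Arith, (simp add: st_simps; fail), simp, (simp add: st_simps; fail))+
      apply (rule runs_Call, rule pow, (simp add: st_simps; fail)+)
      apply (rule runs_Arith, (simp add: st_simps; fail), simp, (simp add: st_simps; fail))+
      apply (rule runs_Nil)
      apply (rule refl)
    using t1 t2 t3 unfolding cube apply linarith
    apply (simp add: st_simps)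
    done
  then obtain s where s: "runs B (1000 * N ^ 3) main_prog (input_memory m n w) s"
    "s = (f (Suc a))(15 := 2, 16 := m, 17 := 2 ^ m - \<nu>, 18 := 0, 0 := 1 - (2 ^ m - \<nu>), 1 := \<nu>)"
    by (elim exE conjE)
  then have "s 0 = 1 - (2 ^ m - \<nu>)" "s 1 = \<nu>"
    by simp_all
  with s(1) show ?thesis by blast
qed

text \<open>
  The exponents come from \<open>modulus \<le> (n + 1) ^ (w + 2)\<close> and \<open>m + w + 2 \<le> 2 * (m + w)\<close>.
\<close>

lemma ample_power: "ample ((n + 1) ^ (8000 * (m + w) ^ 4))"
proof -
  define x where "x = m + w"
  let ?T = "8000 * x ^ 4"
  have x: "2 \<le> x" using m_pos w_pos by (simp add: x_def)
  have x4: "x \<le> x ^ 4" "x ^ 3 \<le> x ^ 4"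
    using power_increasing[of 1 4 x] power_increasing[of 3 4 x] x by simp_all
  have small_exp: "(n + 1) ^ e \<le> (n + 1) ^ ?T" if "e \<le> ?T" for e
    using that by (rule power_increasing) simp
  have n1: "1 \<le> n" using m_pos m_le_n by simp
  have n2: "n + 2 \<le> (n + 1) ^ 2"
    using n1 by (simp add: power2_eq_square)
  have "(n + m + w + 40) \<le> (n + 1) * (x + 40)"
    by (simp add: x_def)
  also have "\<dots> \<le> (n + 1) * (n + 1) ^ (x + 40)"
  proof (rule mult_le_mono2)
    \<comment> \<open>Since \<open>n + 1\<close> is at least 2, factors in \<open>m\<close> and
      \<open>w\<close> are absorbed into its exponent.\<close>
    have "x + 40 \<le> 2 ^ (x + 40)" by (rule less_imp_le[OF less_exp])
    also have "\<dots> \<le> (n + 1) ^ (x + 40)" using n1 by (intro power_mono) simp_all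
    finally show "x + 40 \<le> (n + 1) ^ (x + 40)" .
  qed
  also have "\<dots> = (n + 1) ^ Suc (x + 40)" by (rule power_Suc[symmetric])
  also have "\<dots> \<le> (n + 1) ^ ?T"
    by (rule small_exp) (use x x4(1) in linarith)
  finally have 1: "n + m + w + 40 \<le> (n + 1) ^ ?T" .
  have "(n + 2) ^ (m + w + 2) \<le> ((n + 1) ^ 2) ^ (m + w + 2)"
    using n2 by (rule power_mono) simp
  also have "\<dots> = (n + 1) ^ (2 * (x + 2))" by (simp only: x_def flip: power_mult)
  also have "\<dots> \<le> (n + 1) ^ ?T"
  proof (rule small_exp)
    have "2 * (x + 2) \<le> 4 * x" using x by simp
    also have "\<dots> \<le> ?T" using x4(1) by linarith
    finally show "2 * (x + 2) \<le> ?T" .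
  qed
  finally have 2: "(n + 2) ^ (m + w + 2) \<le> (n + 1) ^ ?T" .
  have modulus: "modulus \<le> (n + 1) ^ (w + 2)"
  proof -
    have "(n + 1) ^ w * 3 \<le> (n + 1) ^ w * (n + 1) ^ 2"
      using n1 n2 by (intro mult_le_mono2) simp
    moreover have "1 \<le> (n + 1) ^ w" by simp
    ultimately show ?thesis unfolding modulus_def power_add by linarith
  qed
  have "modulus ^ (2 * w * (2 * (m + w + 2))) \<le> ((n + 1) ^ (w + 2)) ^ (2 * w * (2 * (m + w + 2)))"
    using modulus by (rule power_mono) simp
  also have "\<dots> = (n + 1) ^ ((w + 2) * (2 * w * (2 * (m + w + 2))))"
    by (rule power_mult[symmetric])
  also have "\<dots> \<le> (n + 1) ^ ?T"
  proof (rule small_exp)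
    have "(w + 2) * (2 * w * (2 * (m + w + 2))) \<le> (2 * x) * (2 * x * (2 * (2 * x)))"
      by (intro mult_le_mono; use m_pos w_pos x_def in linarith)
    also have "\<dots> = 16 * x ^ 3" by (simp add: power3_eq_cube)
    also have "\<dots> \<le> 8000 * x ^ 4" using x4(2) by linarith
    finally show "(w + 2) * (2 * w * (2 * (m + w + 2))) \<le> ?T" .
  qed
  finally have 3: "modulus ^ (2 * w * (2 * (m + w + 2))) \<le> (n + 1) ^ ?T" .
  have "2 * m + 3 \<le> (n + 2) * 2"
    using m_le_n by simp
  also have "\<dots> \<le> (n + 1) ^ 2 * (n + 1)"
    using n1 n2 by (intro mult_le_mono) simp_all
  also have "\<dots> = (n + 1) ^ 3"
    by (simp only: power3_eq_cube power2_eq_square)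
  finally have "2 * m + 3 \<le> (n + 1) ^ 3" .
  moreover have "m + 2 \<le> (n + 1) ^ 2" using n2 m_le_n by simp
  moreover have "2 ^ m \<le> (n + 1) ^ m" using n1 by (intro power_mono) simp_all
  ultimately have "(m + 2) * cost_bound \<le> (n + 1) ^ 2 * ((n + 1) ^ 3 * ((n + 1) ^ m * (n + 1) ^ (w + 2)))"
    unfolding cost_bound_def using modulus by (intro mult_le_mono)
  also have "\<dots> = (n + 1) ^ (x + 7)"
    by (simp only: x_def flip: power_add) (simp add: add.commute add.left_commute)
  also have "\<dots> \<le> (n + 1) ^ ?T"
    by (rule small_exp) (use x x4(1) in linarith)
  finally have "(m + 2) * cost_bound \<le> (n + 1) ^ ?T" .
  with 1 2 3 show ?thesis by (simp only: ample_def flip: x_def)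
qed

text \<open>The factor 8000 is \<open>1000 * 2 ^ 3\<close>, from
  \<open>m + w + 2 \<le> 2 * (m + w)\<close>. The same quantity has to serve as step bound and as
  the exponent that bounds the numbers.\<close>

lemma main_prog_runs_within:
  "\<exists>s. runs_within (8000 * (m + w) ^ 4) main_prog m n w s \<and>
    s 0 = 1 - (2 ^ m - stair cost (Suc a) (Suc b)) \<and> s 1 = stair cost (Suc a) (Suc b)"
proof -
  let ?T = "8000 * (m + w) ^ 4"
  have "1000 * (m + w + 2) ^ 3 \<le> 1000 * (2 * (m + w)) ^ 3"
    using m_pos w_pos by (intro mult_le_mono2 power_mono) simp_all
  also have "\<dots> = 8000 * (m + w) ^ 3"
    unfolding power_mult_distrib by simp
  also have "\<dots> \<le> ?T"
    using m_pos by (intro mult_le_mono2 power_increasing) simp_all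
  finally have T: "1000 * (m + w + 2) ^ 3 \<le> ?T" .
  obtain s where s: "runs ((n + 1) ^ ?T) (1000 * (m + w + 2) ^ 3) main_prog (input_memory m n w) s"
    "s 0 = 1 - (2 ^ m - stair cost (Suc a) (Suc b))" "s 1 = stair cost (Suc a) (Suc b)"
    using runs_main[OF ample_power refl] by blast
  then have "runs_within ?T main_prog m n w s"
    using runs_mono[OF _ T] unfolding runs_within_def runs_def by blast
  with s show ?thesis by blast
qed

end

subsection \<open>Class sizes of an equitable graph\<close>

declare One_nat_def [simp del]

text \<open>The parts of a subset inside and outside \<open>H\<close> are chosen
  independently.\<close>

lemma card_subsets_profile:
  assumes "finite U"
  shows "card {S. S \<subseteq> U \<and> card (S \<inter> H) = p \<and> card (S - H) = q} =
    (card (U \<inter> H) choose p) * (card (U - H) choose q)"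
proof -
  have "card {S. S \<subseteq> U \<and> card (S \<inter> H) = p \<and> card (S - H) = q} =
      card ({A. A \<subseteq> U \<inter> H \<and> card A = p} \<times> {B. B \<subseteq> U - H \<and> card B = q})"
    by (intro bij_betw_same_card[of "\<lambda>S. (S \<inter> H, S - H)"]
        bij_betw_byWitness[where f' = "\<lambda>(A, B). A \<union> B"])
      (auto simp: Int_Un_distrib2 Un_Diff intro!: arg_cong[of _ _ card])
  then show ?thesis
    using assms n_subsets[of "U \<inter> H" p] n_subsets[of "U - H" q] by (simp add: card_cartesian_product)
qed

lemma sum_power_card_subsets:
  assumes "finite B"
  shows "(\<Sum>A | A \<subseteq> B \<and> 1 \<le> card A \<and> card A \<le> w. Z ^ card A) = block_poly w Z (card B)"
proof -
  let ?S = "{A. A \<subseteq> B \<and> 1 \<le> card A \<and> card A \<le> w}"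
  have "(\<Sum>A\<in>?S. Z ^ card A) = (\<Sum>t=1..w. \<Sum>A\<in>{A \<in> ?S. card A = t}. Z ^ card A)"
    by (rule sum.group[symmetric]) (use assms in auto)
  also have "\<dots> = (\<Sum>t=1..w. (card B choose t) * Z ^ t)"
  proof (intro sum.cong refl)
    fix t assume t: "t \<in> {1..w}"
    have "(\<Sum>A\<in>{A \<in> ?S. card A = t}. Z ^ card A) = (\<Sum>A | A \<subseteq> B \<and> card A = t. Z ^ t)"
      using t by (intro sum.cong) auto
    then show "(\<Sum>A\<in>{A \<in> ?S. card A = t}. Z ^ card A) = (card B choose t) * Z ^ t"
      using assms by (simp add: n_subsets)
  qed
  finally show ?thesis by (simp add: block_poly_def)
qed

text \<open>Expanding the product selects one subset per block. The union of the selected sets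
  determines them, and its cardinality is the sum of theirs, because the blocks are
  disjoint.\<close>

lemma sum_power_card_transversals:
  fixes Z :: nat
  assumes "finite I" "\<And>i. i \<in> I \<Longrightarrow> finite (N i)" "disjoint_family_on N I"
  shows "(\<Sum>Y | Y \<subseteq> (\<Union>i\<in>I. N i) \<and> (\<forall>i\<in>I. P i (Y \<inter> N i)). Z ^ card Y) =
    (\<Prod>i\<in>I. \<Sum>A | A \<subseteq> N i \<and> P i A. Z ^ card A)"
proof -
  let ?B = "\<lambda>i. {A. A \<subseteq> N i \<and> P i A}"
  have inter: "(\<Union>i\<in>I. g i) \<inter> N k = g k" if "g \<in> Pi\<^sub>E I ?B" "k \<in> I" for g k
    using that assms(3) by (fastforce simp: disjoint_family_on_def PiE_def Pi_def)
  have "(\<Prod>i\<in>I. \<Sum>A\<in>?B i. Z ^ card A) = (\<Sum>g\<in>Pi\<^sub>E I ?B. \<Prod>i\<in>I. Z ^ card (g i))"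
    using assms by (intro prod_sum_PiE) auto
  also have "\<dots> = (\<Sum>Y | Y \<subseteq> (\<Union>i\<in>I. N i) \<and> (\<forall>i\<in>I. P i (Y \<inter> N i)). Z ^ card Y)"
  proof (rule sum.reindex_bij_witness[where j = "\<lambda>g. \<Union>i\<in>I. g i" and i = "\<lambda>Y. \<lambda>i\<in>I. Y \<inter> N i"])
    fix g assume g: "g \<in> Pi\<^sub>E I ?B"
    show "(\<lambda>i\<in>I. (\<Union>i\<in>I. g i) \<inter> N i) = g"
    proof
      fix k show "(\<lambda>i\<in>I. (\<Union>i\<in>I. g i) \<inter> N i) k = g k"
        using inter[OF g, of k] g by (cases "k \<in> I") (auto simp: PiE_def extensional_def)
    qed
    show "(\<Union>i\<in>I. g i) \<in> {Y. Y \<subseteq> (\<Union>i\<in>I. N i) \<and> (\<forall>i\<in>I. P i (Y \<inter> N i))}"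
      using inter[OF g] g by (auto simp: PiE_def Pi_def)
    have sub: "g i \<subseteq> N i" if "i \<in> I" for i
      using g that by (auto simp: PiE_def Pi_def)
    have "card (\<Union>i\<in>I. g i) = (\<Sum>i\<in>I. card (g i))"
    proof (intro card_UN_disjoint ballI impI)
      show "finite (g i)" if "i \<in> I" for i
        using sub assms(2) that finite_subset by blast
      show "g i \<inter> g k = {}" if "i \<in> I" "k \<in> I" "i \<noteq> k" for i k
        using sub[of i] sub[of k] assms(3) that unfolding disjoint_family_on_def by blast
    qed fact
    then show "Z ^ card (\<Union>i\<in>I. g i) = (\<Prod>i\<in>I. Z ^ card (g i))"
      by (simp add: power_sum)
  next
    fix Y assume "Y \<in> {Y. Y \<subseteq> (\<Union>i\<in>I. N i) \<and> (\<forall>i\<in>I. P i (Y \<inter> N i))}"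
    then show "(\<Union>i\<in>I. (\<lambda>i\<in>I. Y \<inter> N i) i) = Y" "(\<lambda>i\<in>I. Y \<inter> N i) \<in> Pi\<^sub>E I ?B"
      by auto
  qed
  finally show ?thesis ..
qed

text \<open>
  Evaluating a generating function at a large integer \<open>Z\<close>: reduction modulo \<open>Z ^ Suc w\<close> discards
  the terms of degree above \<open>w\<close>, and modulo \<open>Z - 1\<close> every power of \<open>Z\<close> is 1.
\<close>

lemma sum_power_mod_mod:
  assumes "finite S" "card {s \<in> S. c s \<le> w} < Z - 1"
  shows "(\<Sum>s\<in>S. Z ^ c s) mod Z ^ Suc w mod (Z - 1) = card {s \<in> S. c s \<le> w}"
proof -
  let ?S = "{s \<in> S. c s \<le> w}"
  have "(\<Sum>s\<in>S. Z ^ c s) = (\<Sum>s\<in>?S. Z ^ c s) + (\<Sum>s\<in>S - ?S. Z ^ c s)"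
    using assms(1) by (subst sum.subset_diff[of ?S]) auto
  moreover have "Z ^ Suc w dvd (\<Sum>s\<in>S - ?S. Z ^ c s)"
    by (intro dvd_sum le_imp_power_dvd) auto
  ultimately have "(\<Sum>s\<in>S. Z ^ c s) mod Z ^ Suc w = (\<Sum>s\<in>?S. Z ^ c s) mod Z ^ Suc w"
    by (auto simp: mod_add_right_eq elim!: dvdE)
  also have "\<dots> = (\<Sum>s\<in>?S. Z ^ c s)"
  \<comment> \<open>Fewer than \<open>Z\<close> terms remain, each at most \<open>Z ^ w\<close>, so
    the sum is below the divisor.\<close>
  proof (rule mod_less)
    have "(\<Sum>s\<in>?S. Z ^ c s) \<le> (\<Sum>s\<in>?S. Z ^ w)"
      using assms(2) by (intro sum_mono power_increasing) auto
    also have "\<dots> = card ?S * Z ^ w" by simp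
    also have "\<dots> < Z * Z ^ w"
      using assms(2) by (intro mult_strict_right_mono) auto
    finally show "(\<Sum>s\<in>?S. Z ^ c s) < Z ^ Suc w" by simp
  qed
  also have "\<dots> mod (Z - 1) = card ?S"
  proof -
    have Z: "Z = 1 + (Z - 1)" using assms(2) by simp
    have "Z ^ k mod (Z - 1) = 1 mod (Z - 1)" for k
      by (metis Z mod_add_self2 power_mod power_one)
    then have "(\<Sum>s\<in>?S. Z ^ c s mod (Z - 1)) mod (Z - 1) = (\<Sum>s\<in>?S. 1 mod (Z - 1)) mod (Z - 1)"
      by (simp only:)
    then have "(\<Sum>s\<in>?S. Z ^ c s) mod (Z - 1) = (\<Sum>s\<in>?S. 1) mod (Z - 1)"
      by (simp only: mod_sum_eq)
    then show ?thesis using assms(2) by simp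
  qed
  finally show ?thesis .
qed

text \<open>Compare with the binomial expansion of \<open>(n + 1) ^ w\<close> term by term, using
  \<open>n choose s \<le> n ^ s\<close> and \<open>1 \<le> w choose s\<close>.\<close>

lemma card_small_subsets_le: "card {Y. Y \<subseteq> {1..n} \<and> card Y \<le> w} \<le> (n + 1) ^ w"
proof -
  have "card {Y. Y \<subseteq> {1..n} \<and> card Y \<le> w} =
      (\<Sum>s\<le>w. card {Y \<in> {Y. Y \<subseteq> {1..n} \<and> card Y \<le> w}. card Y = s})"
    by (intro sum_card_fibres[symmetric]) auto
  also have "\<dots> = (\<Sum>s\<le>w. n choose s)"
  proof (intro sum.cong refl)
    fix s assume "s \<in> {..w}"
    then have "{Y \<in> {Y. Y \<subseteq> {1..n} \<and> card Y \<le> w}. card Y = s} = {Y. Y \<subseteq> {1..n} \<and> card Y = s}"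
      by auto
    then show "card {Y \<in> {Y. Y \<subseteq> {1..n} \<and> card Y \<le> w}. card Y = s} = n choose s"
      by (simp add: n_subsets)
  qed
  also have "\<dots> \<le> (\<Sum>s\<le>w. (w choose s) * n ^ s)"
  proof (intro sum_mono)
    fix s assume "s \<in> {..w}"
    then have "1 \<le> w choose s" by (simp add: One_nat_def Suc_le_eq)
    moreover have "n choose s \<le> n ^ s"
      by (cases "s \<le> n") (auto simp: binomial_le_pow binomial_eq_0)
    ultimately show "n choose s \<le> (w choose s) * n ^ s"
      by (metis mult_le_mono nat_mult_1)
  qed
  also have "\<dots> = (n + 1) ^ w"
    by (simp add: binomial[of n 1 w])
  finally show ?thesis .
qed

section \<open>Words as subsets\<close>

definition supp :: "nat \<Rightarrow> (nat \<Rightarrow> nat) \<Rightarrow> nat set" where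
  "supp n y = {j \<in> {1..n}. y j \<noteq> 0}"

lemma bij_betw_supp: "bij_betw (supp n) (cube n) (Pow {1..n})"
  by (rule bij_betw_byWitness[where f' = "\<lambda>S. \<lambda>j\<in>{1..n}. of_bool (j \<in> S)"])
    (force simp: supp_def cube_def PiE_def extensional_def restrict_def fun_eq_iff)+

lemma card_cube_supp: "card {y \<in> cube n. P (supp n y)} = card {S. S \<subseteq> {1..n} \<and> P S}"
proof (rule bij_betw_same_card)
  show "bij_betw (supp n) {y \<in> cube n. P (supp n y)} {S. S \<subseteq> {1..n} \<and> P S}"
    unfolding bij_betw_def
  proof
    show "inj_on (supp n) {y \<in> cube n. P (supp n y)}"
      by (rule inj_on_subset[OF bij_betw_imp_inj_on[OF bij_betw_supp]]) simp
    have "supp n ` {y \<in> cube n. P (supp n y)} = {S \<in> supp n ` cube n. P S}"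
      by blast
    then show "supp n ` {y \<in> cube n. P (supp n y)} = {S. S \<subseteq> {1..n} \<and> P S}"
      unfolding bij_betw_imp_surj_on[OF bij_betw_supp] by simp
  qed
qed

lemma finite_cube: "finite (cube n)"
  by (simp add: cube_def finite_PiE)

lemma card_cube: "card (cube n) = 2 ^ n"
  using card_cube_supp[of n "\<lambda>_. True"] by (simp add: card_Pow flip: Pow_def)

lemma finite_hamming_ball: "finite (hamming_ball n w)"
  by (simp add: hamming_ball_def finite_cube)

section \<open>Blocks, profiles and degrees in an equitable graph\<close>

locale equitable_graph = parameters +
  fixes E :: "(nat \<times> nat) set"
  assumes equitable: "equitable m n E"
begin

definition heavy :: "nat set" where "heavy = {i \<in> {1..m}. left_degree E i > d}"
definition block :: "nat \<Rightarrow> nat set" where "block i = {j. (i, j) \<in> E}"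
definition nbrs :: "nat set \<Rightarrow> nat set" where "nbrs Y = {i. \<exists>j\<in>Y. (i, j) \<in> E}"

lemma E_subset: "E \<subseteq> {1..m} \<times> {1..n}"
  using equitable by (simp add: equitable_def domination_graph_def)

lemma block_subset: "block i \<subseteq> {1..n}"
  using E_subset by (auto simp: block_def)

lemma finite_block [simp]: "finite (block i)"
  using block_subset by (rule finite_subset) simp

lemma disjoint_block: "disjoint_family_on block I"
proof -
  have "i = i'" if "(i, j) \<in> E" "(i', j) \<in> E" for i i' j
  proof -
    have "right_degree E j = 1"
      using equitable E_subset that by (auto simp: equitable_def)
    then show ?thesis
      using that unfolding right_degree_def by (metis card_1_singletonE mem_Collect_eq singletonD)
  qed
  then show ?thesis by (auto simp: disjoint_family_on_def block_def)
qed

lemma UN_block: "(\<Union>i\<in>{1..m}. block i) = {1..n}"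
proof
  show "{1..n} \<subseteq> (\<Union>i\<in>{1..m}. block i)"
  proof
    fix j assume "j \<in> {1..n}"
    then obtain i where "(i, j) \<in> E"
      using equitable unfolding equitable_def domination_graph_def by blast
    then show "j \<in> (\<Union>i\<in>{1..m}. block i)"
      using E_subset by (auto simp: block_def)
  qed
qed (use block_subset in auto)

text \<open>The floor of \<open>n / m\<close> is \<open>d\<close> and its ceiling is at most
  \<open>d + 1\<close>, so a degree above \<open>d\<close> can only be \<open>d + 1\<close>.\<close>

lemma card_block: "i \<in> {1..m} \<Longrightarrow> card (block i) = (if i \<in> heavy then d + 1 else d)"
proof -
  assume i: "i \<in> {1..m}"
  have fl: "\<lfloor>real n / real m\<rfloor> = int d"
    unfolding d_def by (simp add: floor_divide_of_nat_eq)
  have "\<lceil>real n / real m\<rceil> \<le> int d + 1" "int d \<le> \<lceil>real n / real m\<rceil>"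
    using fl by linarith+
  then have "left_degree E i = d \<or> left_degree E i = d + 1"
    using equitable i fl by (force simp: equitable_def)
  then show ?thesis
    using i by (auto simp: heavy_def block_def left_degree_def)
qed

lemma heavy_subset: "heavy \<subseteq> {1..m}"
  by (auto simp: heavy_def)

text \<open>The blocks partition \<open>{1..n}\<close>, hence \<open>n = m * d + card heavy\<close>;
  compare with division of \<open>n\<close> by \<open>m\<close>.\<close>

lemma card_heavy: "card heavy = a"
proof -
  have "n = card (\<Union>i\<in>{1..m}. block i)"
    by (simp add: UN_block)
  also have "\<dots> = (\<Sum>i\<in>{1..m}. card (block i))"
    using disjoint_block[of "{1..m}"] by (intro card_UN_disjoint) (auto simp: disjoint_family_on_def)
  also have "\<dots> = (\<Sum>i\<in>{1..m}. d + of_bool (i \<in> heavy))"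
    by (intro sum.cong) (auto simp: card_block)
  also have "\<dots> = m * d + card heavy"
    using heavy_subset by (simp add: sum.distrib Int_absorb1)
  finally show ?thesis
    unfolding a_def d_def by (metis add_left_cancel mult_div_mod_eq)
qed

lemma card_light: "card ({1..m} - heavy) = b"
  using heavy_subset by (simp add: card_Diff_subset finite_subset card_heavy b_def)

lemma profile_eq: "S \<subseteq> {1..m} \<Longrightarrow> profile m n E S = (card (S \<inter> heavy), card (S - heavy))"
  unfolding profile_def heavy_def d_def by (auto intro!: arg_cong[of _ _ card])

lemma profile_le: "S \<subseteq> {1..m} \<Longrightarrow> profile m n E S = (i, j) \<Longrightarrow> i \<le> a \<and> j \<le> b"
  using card_mono[of heavy "S \<inter> heavy"] card_mono[of "{1..m} - heavy" "S - heavy"]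
    finite_subset[OF heavy_subset] card_heavy card_light
  by (auto simp: profile_eq)

lemma card_profile: "card {S. S \<subseteq> {1..m} \<and> profile m n E S = (i, j)} = (a choose i) * (b choose j)"
proof -
  have "{S. S \<subseteq> {1..m} \<and> profile m n E S = (i, j)} =
      {S. S \<subseteq> {1..m} \<and> card (S \<inter> heavy) = i \<and> card (S - heavy) = j}"
    by (auto simp: profile_eq)
  then show ?thesis
    using heavy_subset by (simp add: card_subsets_profile card_heavy card_light Int_absorb1)
qed

lemma card_subsets_of_profile:
  assumes "S \<subseteq> {1..m}" "profile m n E S = (i, j)"
  shows "card {T. T \<subseteq> S \<and> profile m n E T = (i', j')} = (i choose i') * (j choose j')"
proof -
  have "{T. T \<subseteq> S \<and> profile m n E T = (i', j')} =
      {T. T \<subseteq> S \<and> card (T \<inter> heavy) = i' \<and> card (T - heavy) = j'}"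
    using assms by (auto simp: profile_eq)
  then show ?thesis
    using assms by (simp add: card_subsets_profile profile_eq finite_subset[of S "{1..m}"])
qed

text \<open>A superset \<open>S\<close> corresponds to \<open>S - T\<close>, a subset of the
  complement of \<open>T\<close>, which contains \<open>a - i\<close> heavy and \<open>b - j\<close>
  light vertices.\<close>

lemma card_supersets_of_profile:
  assumes T: "T \<subseteq> {1..m}" "profile m n E T = (i, j)"
  shows "card {S. T \<subseteq> S \<and> S \<subseteq> {1..m} \<and> profile m n E S = (i', j')} =
    (if i \<le> i' \<and> j \<le> j' then (a - i choose (i' - i)) * (b - j choose (j' - j)) else 0)"
proof -
  have finT: "finite T" using T finite_subset by blast
  have split: "card (S \<inter> heavy) = i + card ((S - T) \<inter> heavy)" "card (S - heavy) = j + card ((S - T) - heavy)"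
    if "T \<subseteq> S" "S \<subseteq> {1..m}" for S
  proof -
    have finS: "finite S" using that finite_subset by blast
    have "S \<inter> heavy = (T \<inter> heavy) \<union> ((S - T) \<inter> heavy)" "S - heavy = (T - heavy) \<union> ((S - T) - heavy)"
      using that by auto
    then have "card (S \<inter> heavy) = card (T \<inter> heavy) + card ((S - T) \<inter> heavy)"
      "card (S - heavy) = card (T - heavy) + card ((S - T) - heavy)"
      using finS finT by (auto intro!: card_Un_disjoint simp del: Un_Diff_cancel)
    then show "card (S \<inter> heavy) = i + card ((S - T) \<inter> heavy)" "card (S - heavy) = j + card ((S - T) - heavy)"
      using T by (simp_all add: profile_eq)
  qed
  show ?thesis
  proof (cases "i \<le> i' \<and> j \<le> j'")
    case True
    have "card {S. T \<subseteq> S \<and> S \<subseteq> {1..m} \<and> profile m n E S = (i', j')} =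
        card {S. S \<subseteq> {1..m} - T \<and> card (S \<inter> heavy) = i' - i \<and> card (S - heavy) = j' - j}"
    proof (rule bij_betw_same_card[of "\<lambda>S. S - T"], rule bij_betw_byWitness[where f' = "\<lambda>S. S \<union> T"])
      show "(\<lambda>S. S - T) ` {S. T \<subseteq> S \<and> S \<subseteq> {1..m} \<and> profile m n E S = (i', j')} \<subseteq>
          {S. S \<subseteq> {1..m} - T \<and> card (S \<inter> heavy) = i' - i \<and> card (S - heavy) = j' - j}"
      proof (intro image_subsetI)
        fix S assume "S \<in> {S. T \<subseteq> S \<and> S \<subseteq> {1..m} \<and> profile m n E S = (i', j')}"
        then show "S - T \<in> {S. S \<subseteq> {1..m} - T \<and> card (S \<inter> heavy) = i' - i \<and> card (S - heavy) = j' - j}"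
          using split[of S] profile_eq[of S] by auto
      qed
      show "(\<lambda>S. S \<union> T) ` {S. S \<subseteq> {1..m} - T \<and> card (S \<inter> heavy) = i' - i \<and> card (S - heavy) = j' - j} \<subseteq>
          {S. T \<subseteq> S \<and> S \<subseteq> {1..m} \<and> profile m n E S = (i', j')}"
      proof (intro image_subsetI)
        fix S assume S: "S \<in> {S. S \<subseteq> {1..m} - T \<and> card (S \<inter> heavy) = i' - i \<and> card (S - heavy) = j' - j}"
        then have "(S \<union> T) - T = S" "T \<subseteq> S \<union> T" "S \<union> T \<subseteq> {1..m}" using T by auto
        then show "S \<union> T \<in> {S. T \<subseteq> S \<and> S \<subseteq> {1..m} \<and> profile m n E S = (i', j')}"
          using split[of "S \<union> T"] S True by (simp add: profile_eq)
      qed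
    next
      show "\<forall>S\<in>{S. T \<subseteq> S \<and> S \<subseteq> {1..m} \<and> profile m n E S = (i', j')}. S - T \<union> T = S"
        by blast
      show "\<forall>S\<in>{S. S \<subseteq> {1..m} - T \<and> card (S \<inter> heavy) = i' - i \<and> card (S - heavy) = j' - j}. S \<union> T - T = S"
        by blast
    qed
    also have "\<dots> = (card (({1..m} - T) \<inter> heavy) choose (i' - i)) * (card (({1..m} - T) - heavy) choose (j' - j))"
      by (rule card_subsets_profile) simp
    finally show ?thesis
      using split[of "{1..m}"] T heavy_subset card_heavy card_light True by (simp add: Int_absorb1)
  next
    case False
    then have "profile m n E S \<noteq> (i', j')" if "T \<subseteq> S" "S \<subseteq> {1..m}" for S
      using split[OF that] that(2) by (auto simp: profile_eq)
    then have empty: "{S. T \<subseteq> S \<and> S \<subseteq> {1..m} \<and> profile m n E S = (i', j')} = {}"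
      by blast
    show ?thesis
      unfolding empty using False by auto
  qed
qed

lemma left_profile_eq: "left_profile m n E x = profile m n E (supp m x)"
  by (simp add: left_profile_def supp_def)

lemma nbrs_subset: "nbrs Y \<subseteq> {1..m}"
  using E_subset by (auto simp: nbrs_def)

lemma nbrs_supp: "nbrs (supp n y) = {i. \<exists>j. (i, j) \<in> E \<and> y j \<noteq> 0}"
  using E_subset by (fastforce simp: nbrs_def supp_def)

lemma right_profile_eq: "right_profile m n E y = profile m n E (nbrs (supp n y))"
  by (simp add: right_profile_def nbrs_supp)

lemma compatible_iff: "compatible E x y \<longleftrightarrow> nbrs (supp n y) \<subseteq> supp m x"
  using E_subset unfolding nbrs_supp by (fastforce simp: compatible_def supp_def)

lemma hamming_ball_eq: "hamming_ball n w = {y \<in> cube n. card (supp n y) \<le> w}"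
  by (simp add: hamming_ball_def wt_def supp_def)

lemma supp_cube: "x \<in> cube k \<Longrightarrow> supp k x \<subseteq> {1..k}"
  by (auto simp: supp_def)

lemma card_left_class:
  "card {x \<in> cube m. left_profile m n E x = (i, j)} = (a choose i) * (b choose j)"
  using card_cube_supp[of m "\<lambda>S. profile m n E S = (i, j)"] by (simp add: left_profile_eq card_profile)

text \<open>The supports in question lie in the blocks of \<open>T\<close> and meet each of them.
  The bound \<open>w\<close> within a single block follows from the bound on the whole support; it
  is stated so that each factor of the product is a truncated \<open>block_poly\<close>.\<close>

lemma card_nbrs_fibre:
  assumes T: "T \<subseteq> {1..m}" "profile m n E T = (i, j)"
  shows "card {y \<in> hamming_ball n w. nbrs (supp n y) = T} = fibre_size i j"
proof -
  let ?S = "{Y. Y \<subseteq> (\<Union>i\<in>T. block i) \<and> (\<forall>i\<in>T. 1 \<le> card (Y \<inter> block i) \<and> card (Y \<inter> block i) \<le> w)}"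
  have finT: "finite T" using T finite_subset by blast
  have eq: "{Y. Y \<subseteq> {1..n} \<and> card Y \<le> w \<and> nbrs Y = T} = {Y \<in> ?S. card Y \<le> w}"
  proof (intro set_eqI iffI)
    fix Y assume "Y \<in> {Y. Y \<subseteq> {1..n} \<and> card Y \<le> w \<and> nbrs Y = T}"
    then have Y: "Y \<subseteq> {1..n}" "card Y \<le> w" "nbrs Y = T" by simp_all
    have finY: "finite Y" using Y finite_subset by blast
    show "Y \<in> {Y \<in> ?S. card Y \<le> w}"
    proof (intro CollectI conjI ballI)
      show "card Y \<le> w" by fact
    next
      show "Y \<subseteq> (\<Union>i\<in>T. block i)"
      proof
        fix j assume j: "j \<in> Y"
        then have "j \<in> (\<Union>i\<in>{1..m}. block i)"
          using Y UN_block by blast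
        then show "j \<in> (\<Union>i\<in>T. block i)"
          using Y(3) j by (auto simp: nbrs_def block_def)
      qed
    next
      fix i assume "i \<in> T"
      then have "Y \<inter> block i \<noteq> {}"
        using Y by (auto simp: nbrs_def block_def)
      then show "1 \<le> card (Y \<inter> block i)"
        using finY by (simp add: Suc_le_eq card_gt_0_iff One_nat_def)
      show "card (Y \<inter> block i) \<le> w"
        using Y(2) card_mono[OF finY, of "Y \<inter> block i"] by auto
    qed
  next
    fix Y assume "Y \<in> {Y \<in> ?S. card Y \<le> w}"
    then have Y: "Y \<subseteq> (\<Union>i\<in>T. block i)" "\<And>i. i \<in> T \<Longrightarrow> 1 \<le> card (Y \<inter> block i)" "card Y \<le> w"
      by blast+
    have ne: "Y \<inter> block i \<noteq> {}" if "i \<in> T" for i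
      using Y(2)[OF that] by (auto simp: One_nat_def)
    have "nbrs Y = T"
    proof
      show "T \<subseteq> nbrs Y" using ne by (fastforce simp: nbrs_def block_def)
      show "nbrs Y \<subseteq> T"
      proof
        fix i assume "i \<in> nbrs Y"
        then obtain y where y: "y \<in> Y" "y \<in> block i" by (auto simp: nbrs_def block_def)
        then obtain i' where i': "i' \<in> T" "y \<in> block i'" using Y(1) by blast
        then have "i = i'"
          using disjoint_block[of UNIV] y unfolding disjoint_family_on_def by blast
        then show "i \<in> T" using i' by simp
      qed
    qed
    then show "Y \<in> {Y. Y \<subseteq> {1..n} \<and> card Y \<le> w \<and> nbrs Y = T}"
      using Y block_subset by blast
  qed
  have "?S \<subseteq> Pow {1..n}" using block_subset by blast
  then have finS: "finite ?S" by (rule finite_subset) simp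
  have "card {Y \<in> ?S. card Y \<le> w} \<le> card {Y. Y \<subseteq> {1..n} \<and> card Y \<le> w}"
    unfolding eq[symmetric] by (intro card_mono) auto
  also have "\<dots> \<le> (n + 1) ^ w" by (rule card_small_subsets_le)
  finally have small: "card {Y \<in> ?S. card Y \<le> w} < modulus - 1"
    by (simp add: modulus_def)
  have "(\<Sum>Y\<in>?S. modulus ^ card Y) = (\<Prod>i\<in>T. block_poly w modulus (card (block i)))"
    by (subst sum_power_card_transversals[OF finT _ disjoint_block])
      (simp_all only: finite_block sum_power_card_subsets)
  also have "\<dots> = (\<Prod>i\<in>T \<inter> heavy. block_poly w modulus (d + 1)) * (\<Prod>i\<in>T - heavy. block_poly w modulus d)"
  proof -
    have "(\<Prod>i\<in>T. block_poly w modulus (card (block i))) =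
        (\<Prod>i\<in>T \<inter> heavy. block_poly w modulus (card (block i))) * (\<Prod>i\<in>T - heavy. block_poly w modulus (card (block i)))"
      using finT by (metis prod.Int_Diff)
    also have "(\<Prod>i\<in>T \<inter> heavy. block_poly w modulus (card (block i))) = (\<Prod>i\<in>T \<inter> heavy. block_poly w modulus (d + 1))"
      using T card_block by (intro prod.cong) auto
    also have "(\<Prod>i\<in>T - heavy. block_poly w modulus (card (block i))) = (\<Prod>i\<in>T - heavy. block_poly w modulus d)"
      using T card_block by (intro prod.cong) auto
    finally show ?thesis .
  qed
  also have "\<dots> = block_poly w modulus (d + 1) ^ i * block_poly w modulus d ^ j"
    using T by (simp add: profile_eq)
  finally have "fibre_size i j = card {Y \<in> ?S. card Y \<le> w}"
    using sum_power_mod_mod[OF finS small] by (simp add: fibre_size_def)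
  moreover have "card {y \<in> hamming_ball n w. nbrs (supp n y) = T} =
      card {Y. Y \<subseteq> {1..n} \<and> card Y \<le> w \<and> nbrs Y = T}"
    using card_cube_supp[of n "\<lambda>Y. card Y \<le> w \<and> nbrs Y = T"] by (simp add: hamming_ball_eq)
  ultimately show ?thesis by (simp add: eq)
qed

text \<open>With \<open>C\<close> the sets of a given profile this counts a right class; with
  \<open>C\<close> restricted to subsets of the support of \<open>x\<close> it counts the neighbours
  of \<open>x\<close> in that class.\<close>

lemma card_nbrs_fibres:
  assumes "\<And>T. T \<in> C \<Longrightarrow> T \<subseteq> {1..m} \<and> profile m n E T = (i, j)"
  shows "card {y \<in> hamming_ball n w. nbrs (supp n y) \<in> C} = card C * fibre_size i j"
proof -
  have "finite C"
    by (rule finite_subset[of _ "Pow {1..m}"]) (use assms in auto)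
  then have "card {y \<in> hamming_ball n w. nbrs (supp n y) \<in> C} =
      (\<Sum>T\<in>C. card {y \<in> {y \<in> hamming_ball n w. nbrs (supp n y) \<in> C}. nbrs (supp n y) = T})"
    by (intro sum_card_fibres[symmetric]) (auto simp: finite_hamming_ball)
  also have "\<dots> = (\<Sum>T\<in>C. fibre_size i j)"
  proof (intro sum.cong refl)
    fix T assume T: "T \<in> C"
    then have "{y \<in> {y \<in> hamming_ball n w. nbrs (supp n y) \<in> C}. nbrs (supp n y) = T} =
        {y \<in> hamming_ball n w. nbrs (supp n y) = T}" by auto
    then show "card {y \<in> {y \<in> hamming_ball n w. nbrs (supp n y) \<in> C}. nbrs (supp n y) = T} = fibre_size i j"
      using card_nbrs_fibre assms[OF T] by simp
  qed
  finally show ?thesis by simp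
qed

lemma card_right_class:
  "card {y \<in> hamming_ball n w. right_profile m n E y = (i, j)} = (a choose i) * (b choose j) * fibre_size i j"
  using card_nbrs_fibres[of "{S. S \<subseteq> {1..m} \<and> profile m n E S = (i, j)}" i j] nbrs_subset
  by (simp add: right_profile_eq card_profile)

lemma finite_compatibility_edges: "finite (compatibility_edges m n w E)"
  by (rule finite_subset[of _ "cube m \<times> hamming_ball n w"])
    (auto simp: compatibility_edges_def finite_cube finite_hamming_ball)

lemma compatible_profile_le:
  assumes "compatible E x y" "x \<in> cube m"
  shows "fst (right_profile m n E y) \<le> fst (left_profile m n E x)"
    "snd (right_profile m n E y) \<le> snd (left_profile m n E x)"
proof -
  have sub: "nbrs (supp n y) \<subseteq> supp m x" "supp m x \<subseteq> {1..m}"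
    using assms supp_cube by (simp_all add: compatible_iff)
  then have "finite (supp m x)" using finite_subset by blast
  then show "fst (right_profile m n E y) \<le> fst (left_profile m n E x)"
    "snd (right_profile m n E y) \<le> snd (left_profile m n E x)"
    using sub nbrs_subset unfolding left_profile_eq right_profile_eq
    by (auto simp: profile_eq intro!: card_mono)
qed

text \<open>Biregularity: the degree of \<open>x\<close> into a right class counts subsets of its
  support, the degree of \<open>y\<close> into a left class counts supersets of its neighbour set,
  and both counts depend on profiles only.\<close>

theorem class_lp_optimal_value:
  "lp_optimal_value (class_lp m n w E) (max_matching_size (compatibility_edges m n w E))"
  unfolding class_lp_eq_quotient_lp
proof (rule quotient_lp_optimal_value)
  show "finite (cube m)" "finite (hamming_ball n w)"
    by (rule finite_cube finite_hamming_ball)+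
  show "compatibility_edges m n w E \<subseteq> cube m \<times> hamming_ball n w"
    by (auto simp: compatibility_edges_def)
next
  fix x y assume "(x, y) \<in> compatibility_edges m n w E"
  then show "fst (right_profile m n E y) \<le> fst (left_profile m n E x) \<and>
      snd (right_profile m n E y) \<le> snd (left_profile m n E x)"
    using compatible_profile_le by (auto simp: compatibility_edges_def)
next
  fix x x' and q :: "nat \<times> nat" assume x: "x \<in> cube m" "x' \<in> cube m" "left_profile m n E x = left_profile m n E x'"
  obtain i j where ij: "left_profile m n E x' = (i, j)" by (cases "left_profile m n E x'")
  obtain i' j' where q: "q = (i', j')" by (cases q)
  have "card {y. (x, y) \<in> compatibility_edges m n w E \<and> right_profile m n E y = q} =
      (i choose i') * (j choose j') * fibre_size i' j'"
    if x: "x \<in> cube m" "left_profile m n E x = (i, j)" for x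
  proof -
    let ?C = "{T. T \<subseteq> supp m x \<and> profile m n E T = (i', j')}"
    have "{y. (x, y) \<in> compatibility_edges m n w E \<and> right_profile m n E y = q} =
        {y \<in> hamming_ball n w. nbrs (supp n y) \<in> ?C}"
      using x by (auto simp: compatibility_edges_def compatible_iff right_profile_eq q)
    moreover have "card {y \<in> hamming_ball n w. nbrs (supp n y) \<in> ?C} = card ?C * fibre_size i' j'"
      using supp_cube[OF x(1)] by (intro card_nbrs_fibres) auto
    moreover have "card ?C = (i choose i') * (j choose j')"
      using card_subsets_of_profile[of "supp m x" i j i' j'] supp_cube[OF x(1)] x(2)
      by (simp add: left_profile_eq)
    ultimately show ?thesis by simp
  qed
  from this[of x] this[of x'] show "card {y. (x, y) \<in> compatibility_edges m n w E \<and> right_profile m n E y = q} =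
      card {y. (x', y) \<in> compatibility_edges m n w E \<and> right_profile m n E y = q}"
    using x ij by simp
next
  have card_nbhd: "card {x. (x, y) \<in> compatibility_edges m n w E \<and> left_profile m n E x = (i', j')} =
      (if i \<le> i' \<and> j \<le> j' then (a - i choose (i' - i)) * (b - j choose (j' - j)) else 0)"
    if y: "y \<in> hamming_ball n w" "right_profile m n E y = (i, j)" for y i j i' j'
  proof -
    have "{x. (x, y) \<in> compatibility_edges m n w E \<and> left_profile m n E x = (i', j')} =
        {x \<in> cube m. nbrs (supp n y) \<subseteq> supp m x \<and> profile m n E (supp m x) = (i', j')}"
      using y by (auto simp: compatibility_edges_def compatible_iff left_profile_eq)
    then have "card {x. (x, y) \<in> compatibility_edges m n w E \<and> left_profile m n E x = (i', j')} =
        card {x \<in> cube m. nbrs (supp n y) \<subseteq> supp m x \<and> profile m n E (supp m x) = (i', j')}"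
      by (rule arg_cong)
    also have "\<dots> = card {S. S \<subseteq> {1..m} \<and> nbrs (supp n y) \<subseteq> S \<and> profile m n E S = (i', j')}"
      by (rule card_cube_supp)
    also have "\<dots> = card {S. nbrs (supp n y) \<subseteq> S \<and> S \<subseteq> {1..m} \<and> profile m n E S = (i', j')}"
      by (rule arg_cong[of _ _ card]) blast
    also have "\<dots> = (if i \<le> i' \<and> j \<le> j' then (a - i choose (i' - i)) * (b - j choose (j' - j)) else 0)"
      using y nbrs_subset by (intro card_supersets_of_profile) (simp_all add: right_profile_eq)
    finally show ?thesis .
  qed
  {
    fix y y' and p :: "nat \<times> nat" assume y: "y \<in> hamming_ball n w" "y' \<in> hamming_ball n w" "right_profile m n E y = right_profile m n E y'"
    show "card {x. (x, y) \<in> compatibility_edges m n w E \<and> left_profile m n E x = p} =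
        card {x. (x, y') \<in> compatibility_edges m n w E \<and> left_profile m n E x = p}"
      using card_nbhd[OF y(1)] card_nbhd[OF y(2)] y(3)
      by (cases "right_profile m n E y'"; cases p) simp
  next
    fix p q :: "nat \<times> nat" assume p: "p \<in> left_profile m n E ` cube m" and q: "q \<in> right_profile m n E ` hamming_ball n w"
      and le: "fst q \<le> fst p \<and> snd q \<le> snd p"
    obtain y where y: "y \<in> hamming_ball n w" "right_profile m n E y = q" using q by blast
    obtain i j where qij: "q = (i, j)" by (cases q)
    obtain i' j' where pij: "p = (i', j')" by (cases p)
    obtain x where x: "x \<in> cube m" "profile m n E (supp m x) = (i', j')"
      using p unfolding left_profile_eq pij by fastforce
    have "i' \<le> a" "j' \<le> b"
      using profile_le[OF supp_cube[OF x(1)] x(2)] by simp_all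
    \<comment> \<open>The degree of \<open>y\<close> into class \<open>p\<close> is a product of two
      binomials, nonzero because \<open>i' \<le> a\<close> and \<open>j' \<le> b\<close>.\<close>
    then have "card {x. (x, y) \<in> compatibility_edges m n w E \<and> left_profile m n E x = (i', j')} \<noteq> 0"
      using le card_nbhd[OF y(1) y(2)[unfolded qij], of i' j']
      by (simp add: qij pij not_less diff_le_mono)
    then have "{x. (x, y) \<in> compatibility_edges m n w E \<and> left_profile m n E x = p} \<noteq> {}"
      unfolding pij by (intro notI) simp
    then obtain x' where x': "(x', y) \<in> compatibility_edges m n w E" "left_profile m n E x' = p"
      by blast
    show "\<exists>(x, y)\<in>compatibility_edges m n w E. left_profile m n E x = p \<and> right_profile m n E y = q"
      by (rule bexI[OF _ x'(1)]) (simp add: x'(2) y(2))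
  }
qed

end

section \<open>Vertex covers of the second graph and staircases\<close>

context equitable_graph
begin

definition blowup :: "((nat \<Rightarrow> nat) \<times> (nat \<Rightarrow> nat)) set" where
  "blowup = {(x, y) \<in> cube m \<times> hamming_ball n w.
     fst (right_profile m n E y) \<le> fst (left_profile m n E x) \<and>
     snd (right_profile m n E y) \<le> snd (left_profile m n E x)}"

lemma left_profile_le: "x \<in> cube m \<Longrightarrow> left_profile m n E x \<in> {..a} \<times> {..b}"
  using profile_le[OF supp_cube, of x] by (cases "left_profile m n E x") (simp add: left_profile_eq)

lemma right_profile_le: "right_profile m n E y \<in> {..a} \<times> {..b}"
  using profile_le[OF nbrs_subset, of "supp n y"] by (cases "right_profile m n E y") (simp add: right_profile_eq)

lemma finite_blowup: "finite blowup"
  by (rule finite_subset[of _ "cube m \<times> hamming_ball n w"])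
    (auto simp: blowup_def finite_cube finite_hamming_ball)

text \<open>Biregularity is immediate here, since adjacency depends on the profiles alone.\<close>

lemma class_lp_optimal_value_blowup: "lp_optimal_value (class_lp m n w E) (max_matching_size blowup)"
  unfolding class_lp_eq_quotient_lp
proof (rule quotient_lp_optimal_value)
  show "finite (cube m)" "finite (hamming_ball n w)"
    by (rule finite_cube finite_hamming_ball)+
  show "blowup \<subseteq> cube m \<times> hamming_ball n w"
    by (auto simp: blowup_def)
  show "fst (right_profile m n E y) \<le> fst (left_profile m n E x) \<and>
      snd (right_profile m n E y) \<le> snd (left_profile m n E x)" if "(x, y) \<in> blowup" for x y
    using that by (simp add: blowup_def)
  show "card {y. (x, y) \<in> blowup \<and> right_profile m n E y = q} =
      card {y. (x', y) \<in> blowup \<and> right_profile m n E y = q}"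
    if "x \<in> cube m" "x' \<in> cube m" "left_profile m n E x = left_profile m n E x'" for x x' q
    using that by (simp add: blowup_def)
  show "card {x. (x, y) \<in> blowup \<and> left_profile m n E x = p} =
      card {x. (x, y') \<in> blowup \<and> left_profile m n E x = p}"
    if "y \<in> hamming_ball n w" "y' \<in> hamming_ball n w" "right_profile m n E y = right_profile m n E y'" for y y' p
    using that by (simp add: blowup_def)
  show "\<exists>(x, y)\<in>blowup. left_profile m n E x = p \<and> right_profile m n E y = q"
    if "p \<in> left_profile m n E ` cube m" "q \<in> right_profile m n E ` hamming_ball n w"
      "fst q \<le> fst p \<and> snd q \<le> snd p" for p q
    using that unfolding blowup_def by blast
qed

text \<open>The two sets are the left words above and the right words below the graph of
  \<open>h\<close>; counting them class by class gives one column cost per first component.\<close>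

lemma staircase_cut:
  assumes "\<And>i. h i \<le> Suc b"
  shows "card {x \<in> cube m. \<not> snd (left_profile m n E x) < h (fst (left_profile m n E x))} +
    card {y \<in> hamming_ball n w. snd (right_profile m n E y) < h (fst (right_profile m n E y))} =
    (\<Sum>c<Suc a. column_cost (a - c) (h (a - c)))"
proof -
  let ?X = "{x \<in> cube m. \<not> snd (left_profile m n E x) < h (fst (left_profile m n E x))}"
  let ?Y = "{y \<in> hamming_ball n w. snd (right_profile m n E y) < h (fst (right_profile m n E y))}"
  have "card ?X = (\<Sum>p\<in>Sigma {..a} (\<lambda>i. {h i..b}). card {x \<in> ?X. left_profile m n E x = p})"
  proof (intro sum_card_fibres[symmetric] image_subsetI)
    fix x assume "x \<in> ?X"
    then show "left_profile m n E x \<in> Sigma {..a} (\<lambda>i. {h i..b})"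
      using left_profile_le[of x] by (cases "left_profile m n E x") auto
  qed (auto simp: finite_cube)
  also have "\<dots> = (\<Sum>p\<in>Sigma {..a} (\<lambda>i. {h i..b}). (a choose fst p) * (b choose snd p))"
  proof (intro sum.cong refl)
    fix p assume p: "p \<in> Sigma {..a} (\<lambda>i. {h i..b})"
    then have "{x \<in> ?X. left_profile m n E x = p} = {x \<in> cube m. left_profile m n E x = (fst p, snd p)}"
      by (auto simp: not_less)
    then show "card {x \<in> ?X. left_profile m n E x = p} = (a choose fst p) * (b choose snd p)"
      by (simp only: card_left_class)
  qed
  also have "\<dots> = (\<Sum>i\<le>a. \<Sum>j=h i..b. (a choose i) * (b choose j))"
    by (subst sum.Sigma) (auto simp: case_prod_beta)
  finally have X: "card ?X = (\<Sum>i\<le>a. \<Sum>j=h i..b. (a choose i) * (b choose j))" .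
  have "card ?Y = (\<Sum>p\<in>Sigma {..a} (\<lambda>i. {..<h i}). card {y \<in> ?Y. right_profile m n E y = p})"
  proof (intro sum_card_fibres[symmetric] image_subsetI)
    fix y assume "y \<in> ?Y"
    then show "right_profile m n E y \<in> Sigma {..a} (\<lambda>i. {..<h i})"
      using right_profile_le[of y] by (cases "right_profile m n E y") auto
  qed (auto simp: finite_hamming_ball)
  also have "\<dots> = (\<Sum>p\<in>Sigma {..a} (\<lambda>i. {..<h i}). (a choose fst p) * (b choose snd p) * fibre_size (fst p) (snd p))"
  proof (intro sum.cong refl)
    fix p assume p: "p \<in> Sigma {..a} (\<lambda>i. {..<h i})"
    then have "{y \<in> ?Y. right_profile m n E y = p} = {y \<in> hamming_ball n w. right_profile m n E y = (fst p, snd p)}"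
      by auto
    then show "card {y \<in> ?Y. right_profile m n E y = p} = (a choose fst p) * (b choose snd p) * fibre_size (fst p) (snd p)"
      by (simp only: card_right_class)
  qed
  also have "\<dots> = (\<Sum>i\<le>a. \<Sum>j<h i. (a choose i) * (b choose j) * fibre_size i j)"
    by (subst sum.Sigma) (auto simp: case_prod_beta)
  finally have "card ?X + card ?Y = (\<Sum>i<Suc a. column_cost i (h i))"
    by (simp add: X column_cost_def lessThan_Suc_atMost flip: sum.distrib add.commute)
  \<comment> \<open>Columns are reversed to match the order in which \<open>stair\<close> treats
    them.\<close>
  also have "\<dots> = (\<Sum>c<Suc a. column_cost (a - c) (h (a - c)))"
    using sum.nat_diff_reindex[of "\<lambda>i. column_cost i (h i)" "Suc a"] by simp
  finally show ?thesis .
qed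

text \<open>A staircase yields a cover, so the matching is no larger. Conversely let
  \<open>D\<close> be the down-set generated by the profiles of the left words missed by a Koenig
  cover. A left word with profile outside \<open>D\<close> lies in \<open>A\<close>; a right word
  with profile in \<open>D\<close> is adjacent to a missed word and so lies in \<open>B\<close>. The
  staircase of \<open>D\<close> is therefore no dearer than that cover.\<close>

lemma max_matching_size_blowup:
  "max_matching_size blowup = stair (\<lambda>c. column_cost (a - c)) (Suc a) (Suc b)"
proof (rule antisym)
  obtain k where k: "mono k" "\<And>c. k c \<le> Suc b"
    "stair (\<lambda>c. column_cost (a - c)) (Suc a) (Suc b) = (\<Sum>c<Suc a. column_cost (a - c) (k c))"
    using stair_attained[of "Suc b" "\<lambda>c. column_cost (a - c)" "Suc a"] by blast
  let ?X = "{x \<in> cube m. \<not> snd (left_profile m n E x) < k (a - fst (left_profile m n E x))}"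
  let ?Y = "{y \<in> hamming_ball n w. snd (right_profile m n E y) < k (a - fst (right_profile m n E y))}"
  have "fst e \<in> ?X \<or> snd e \<in> ?Y" if "e \<in> blowup" for e
  proof (cases "fst e \<in> ?X")
    case False
    obtain x y where e: "e = (x, y)" by (cases e)
    have xy: "x \<in> cube m" "y \<in> hamming_ball n w" "fst (right_profile m n E y) \<le> fst (left_profile m n E x)"
      "snd (right_profile m n E y) \<le> snd (left_profile m n E x)"
      using that by (auto simp: e blowup_def)
    have "snd (right_profile m n E y) < k (a - fst (left_profile m n E x))"
      using False xy e by simp
    \<comment> \<open>As \<open>k\<close> increases with the reversed index, the heights fall with
      the first component, and the region below them is a down-set.\<close>
    also have "\<dots> \<le> k (a - fst (right_profile m n E y))"
      using xy by (intro monoD[OF k(1)]) simp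
    finally show ?thesis using xy e by simp
  qed simp
  moreover obtain M where "matching blowup M" "card M = max_matching_size blowup"
    using max_matching_size(2)[OF finite_blowup] by blast
  ultimately have "max_matching_size blowup \<le> card ?X + card ?Y"
    using matching_le_cover[of blowup M ?X ?Y] finite_cube finite_hamming_ball by simp
  also have "\<dots> = (\<Sum>c<Suc a. column_cost (a - c) (k (a - (a - c))))"
    using k(2) by (intro staircase_cut)
  also have "\<dots> = stair (\<lambda>c. column_cost (a - c)) (Suc a) (Suc b)"
    unfolding k(3) by (intro sum.cong) auto
  finally show "max_matching_size blowup \<le> stair (\<lambda>c. column_cost (a - c)) (Suc a) (Suc b)" .
next
  obtain A B where AB: "finite A" "finite B" "\<forall>e\<in>blowup. fst e \<in> A \<or> snd e \<in> B"
    "card A + card B = max_matching_size blowup"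
    using koenig[OF finite_blowup] by blast
  define D where "D = {(i, j). \<exists>x\<in>cube m - A. i \<le> fst (left_profile m n E x) \<and> j \<le> snd (left_profile m n E x)}"
  \<comment> \<open>The column heights of \<open>D\<close>; the least element exists because no left
    profile has a second component above \<open>b\<close>.\<close>
  define h where "h i = (LEAST j. (i, j) \<notin> D)" for i
  have out: "(i, Suc b) \<notin> D" for i
    using left_profile_le by (fastforce simp: D_def)
  have h_le: "h i \<le> Suc b" for i
    unfolding h_def by (rule Least_le) (rule out)
  have h_out: "(i, h i) \<notin> D" for i
    unfolding h_def by (rule LeastI) (rule out)
  have D_iff: "(i, j) \<in> D \<longleftrightarrow> j < h i" for i j
  proof
    assume "(i, j) \<in> D"
    then have "(i, j') \<in> D" if "j' \<le> j" for j'
      using that by (force simp: D_def)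
    then show "j < h i"
      using h_out[of i] not_less by blast
  next
    assume "j < h i"
    then show "(i, j) \<in> D"
      unfolding h_def using not_less_Least by blast
  qed
  have anti: "h i' \<le> h i" if "i \<le> i'" for i i'
  proof -
    have "(i', h i) \<notin> D"
      using h_out[of i] that by (force simp: D_def)
    then show ?thesis by (simp add: D_iff)
  qed
  have "stair (\<lambda>c. column_cost (a - c)) (Suc a) (Suc b) \<le> (\<Sum>c<Suc a. column_cost (a - c) (h (a - c)))"
    using h_le anti by (intro stair_le_sum) (auto simp: mono_def diff_le_mono2)
  also have "\<dots> = card {x \<in> cube m. \<not> snd (left_profile m n E x) < h (fst (left_profile m n E x))} +
    card {y \<in> hamming_ball n w. snd (right_profile m n E y) < h (fst (right_profile m n E y))}"
    using staircase_cut[OF h_le] ..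
  also have "\<dots> \<le> card A + card B"
  proof (intro add_mono card_mono AB subsetI)
    fix x assume "x \<in> {x \<in> cube m. \<not> snd (left_profile m n E x) < h (fst (left_profile m n E x))}"
    then have "x \<in> cube m" "left_profile m n E x \<notin> D"
      using D_iff[of "fst (left_profile m n E x)" "snd (left_profile m n E x)"] by auto
    then show "x \<in> A"
      by (cases "left_profile m n E x") (force simp: D_def)
  next
    fix y assume y: "y \<in> {y \<in> hamming_ball n w. snd (right_profile m n E y) < h (fst (right_profile m n E y))}"
    then have "right_profile m n E y \<in> D"
      using D_iff[of "fst (right_profile m n E y)" "snd (right_profile m n E y)"] by auto
    then obtain x where "x \<in> cube m - A" "(x, y) \<in> blowup"
      using y by (auto simp: D_def blowup_def)
    then show "y \<in> B" using AB(3) by auto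
  qed
  finally show "stair (\<lambda>c. column_cost (a - c)) (Suc a) (Suc b) \<le> max_matching_size blowup"
    using AB(4) by simp
qed

section \<open>Size of the linear program\<close>

lemma card_nbrs_le: "finite Y \<Longrightarrow> Y \<subseteq> {1..n} \<Longrightarrow> card (nbrs Y) \<le> card Y"
proof -
  assume Y: "finite Y" "Y \<subseteq> {1..n}"
  have "nbrs Y = (\<Union>j\<in>Y. {i. (i, j) \<in> E})"
    by (auto simp: nbrs_def)
  then have "card (nbrs Y) \<le> (\<Sum>j\<in>Y. card {i. (i, j) \<in> E})"
    using Y by (simp add: card_UN_le)
  also have "\<dots> = (\<Sum>j\<in>Y. 1)"
    using equitable Y by (intro sum.cong) (auto simp: equitable_def right_degree_def)
  finally show ?thesis by simp
qed

text \<open>Every right vertex has one neighbour, so the neighbour set of a support is no larger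
  than the support. This bounds the number of right classes in terms of \<open>w\<close>
  alone.\<close>

lemma right_profile_le_w:
  assumes "y \<in> hamming_ball n w"
  shows "right_profile m n E y \<in> {..w} \<times> {..w}"
proof -
  have Y: "supp n y \<subseteq> {1..n}" "card (supp n y) \<le> w"
    using assms by (auto simp: hamming_ball_eq supp_def)
  have "card (nbrs (supp n y)) \<le> w"
    using card_nbrs_le[of "supp n y"] Y finite_subset[OF Y(1)] by simp
  moreover have "finite (nbrs (supp n y))"
    using nbrs_subset finite_subset by blast
  then have "card (nbrs (supp n y) \<inter> heavy) \<le> card (nbrs (supp n y))"
    "card (nbrs (supp n y) - heavy) \<le> card (nbrs (supp n y))"
    by (auto intro: card_mono)
  ultimately show ?thesis
    by (simp add: right_profile_eq profile_eq[OF nbrs_subset])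
qed

lemma card_left_profiles: "card (left_profile m n E ` cube m) \<le> 4 * m\<^sup>2"
proof -
  have "left_profile m n E ` cube m \<subseteq> {..a} \<times> {..b}"
    using left_profile_le by blast
  then have "card (left_profile m n E ` cube m) \<le> card ({..a} \<times> {..b})"
    by (intro card_mono) auto
  also have "\<dots> \<le> (2 * m) * (2 * m)"
    unfolding card_cartesian_product using a_less m_pos by (intro mult_mono) (auto simp: b_def)
  finally show ?thesis by (simp add: power2_eq_square)
qed

lemma card_right_profiles:
  shows "card (right_profile m n E ` hamming_ball n w) \<le> 4 * w\<^sup>2"
proof -
  have "right_profile m n E ` hamming_ball n w \<subseteq> {..w} \<times> {..w}"
    using right_profile_le_w by blast
  then have "card (right_profile m n E ` hamming_ball n w) \<le> card ({..w} \<times> {..w})"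
    by (intro card_mono) auto
  also have "\<dots> \<le> (2 * w) * (2 * w)"
    unfolding card_cartesian_product using w_pos by (intro mult_mono) auto
  finally show ?thesis by (simp add: power2_eq_square)
qed

lemma class_lp_vars_bound:
  shows "finite (lp_vars (class_lp m n w E))" "card (lp_vars (class_lp m n w E)) \<le> 16 * (m\<^sup>2 * w\<^sup>2)"
proof -
  have sub: "lp_vars (class_lp m n w E) \<subseteq> left_profile m n E ` cube m \<times> right_profile m n E ` hamming_ball n w"
    by (auto simp: class_lp_def Let_def)
  have fin: "finite (left_profile m n E ` cube m \<times> right_profile m n E ` hamming_ball n w)"
    by (simp add: finite_cube finite_hamming_ball)
  show "finite (lp_vars (class_lp m n w E))"
    by (rule finite_subset[OF sub fin])
  have "card (lp_vars (class_lp m n w E)) \<le> card (left_profile m n E ` cube m \<times> right_profile m n E ` hamming_ball n w)"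
    by (rule card_mono[OF fin sub])
  also have "\<dots> \<le> (4 * m\<^sup>2) * (4 * w\<^sup>2)"
    unfolding card_cartesian_product using card_left_profiles card_right_profiles by (rule mult_le_mono)
  finally show "card (lp_vars (class_lp m n w E)) \<le> 16 * (m\<^sup>2 * w\<^sup>2)" by simp
qed

lemma class_lp_constraints_bound:
  shows "finite (lp_constraints (class_lp m n w E))"
    "card (lp_constraints (class_lp m n w E)) \<le> 16 * (m\<^sup>2 + w\<^sup>2)"
proof -
  have eq: "lp_constraints (class_lp m n w E) = left_profile m n E ` cube m <+> right_profile m n E ` hamming_ball n w"
    by (simp add: class_lp_def Let_def)
  show "finite (lp_constraints (class_lp m n w E))"
    unfolding eq by (intro finite_Plus finite_imageI finite_cube finite_hamming_ball)
  show "card (lp_constraints (class_lp m n w E)) \<le> 16 * (m\<^sup>2 + w\<^sup>2)"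
    using card_left_profiles card_right_profiles unfolding eq
    by (simp add: card_Plus finite_cube finite_hamming_ball)
qed

section \<open>Dominating maps as saturating matchings\<close>

lemma max_matching_size_le: "max_matching_size (compatibility_edges m n w E) \<le> 2 ^ m"
proof -
  obtain M where M: "matching (compatibility_edges m n w E) M"
    "card M = max_matching_size (compatibility_edges m n w E)"
    using max_matching_size(2)[OF finite_compatibility_edges] by blast
  have "card M \<le> card (cube m)"
    using M(1) by (intro card_inj_on_le[of fst]) (auto simp: matching_def compatibility_edges_def finite_cube)
  then show ?thesis by (simp add: M(2) card_cube)
qed

text \<open>The graph of a dominating map is a matching that saturates all \<open>2 ^ m\<close> left
  words; conversely, in a matching of that size every left word has a partner, which serves as its
  image.\<close>

lemma dominating_iff:
  "(\<exists>\<phi>. dominating m n w E \<phi>) \<longleftrightarrow> max_matching_size (compatibility_edges m n w E) = 2 ^ m"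
proof
  assume "\<exists>\<phi>. dominating m n w E \<phi>"
  then obtain \<phi> where \<phi>: "dominating m n w E \<phi>" ..
  have "matching (compatibility_edges m n w E) ((\<lambda>x. (x, \<phi> x)) ` cube m)"
    unfolding matching_def
  proof (intro conjI)
    show "(\<lambda>x. (x, \<phi> x)) ` cube m \<subseteq> compatibility_edges m n w E"
      using \<phi> by (auto simp: dominating_def compatibility_edges_def)
    show "inj_on fst ((\<lambda>x. (x, \<phi> x)) ` cube m)"
      by (rule inj_on_imageI) (simp add: comp_def)
    show "inj_on snd ((\<lambda>x. (x, \<phi> x)) ` cube m)"
      using \<phi> by (intro inj_on_imageI) (simp add: comp_def dominating_def)
  qed
  then have "card ((\<lambda>x. (x, \<phi> x)) ` cube m) \<le> max_matching_size (compatibility_edges m n w E)"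
    by (rule max_matching_size(1)[OF finite_compatibility_edges])
  moreover have "card ((\<lambda>x. (x, \<phi> x)) ` cube m) = 2 ^ m"
    by (subst card_image) (auto simp: inj_on_def card_cube)
  ultimately show "max_matching_size (compatibility_edges m n w E) = 2 ^ m"
    using max_matching_size_le by simp
next
  assume max: "max_matching_size (compatibility_edges m n w E) = 2 ^ m"
  obtain M where M: "matching (compatibility_edges m n w E) M" "card M = 2 ^ m"
    using max_matching_size(2)[OF finite_compatibility_edges] max by metis
  have sub: "M \<subseteq> compatibility_edges m n w E" and inj: "inj_on fst M" "inj_on snd M"
    using M(1) by (simp_all add: matching_def)
  have "fst ` M \<subseteq> cube m"
    using sub by (auto simp: compatibility_edges_def)
  moreover have "card (fst ` M) = card (cube m)"
    using M(2) inj by (simp add: card_image card_cube)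
  ultimately have im: "fst ` M = cube m"
    by (intro card_subset_eq finite_cube)
  define \<phi> where "\<phi> x = snd (the_inv_into M fst x)" for x
  have edge: "(x, \<phi> x) \<in> M" if "x \<in> cube m" for x
  proof -
    have "the_inv_into M fst x \<in> M" "fst (the_inv_into M fst x) = x"
      using that im inj the_inv_into_into[of fst M x M] f_the_inv_into_f[of fst M x] by auto
    then show ?thesis by (metis \<phi>_def prod.collapse)
  qed
  have "dominating m n w E \<phi>"
    unfolding dominating_def
  proof (intro conjI ballI)
    show "\<phi> \<in> cube m \<rightarrow> hamming_ball n w"
      using edge sub by (auto simp: compatibility_edges_def)
    show "compatible E x (\<phi> x)" if "x \<in> cube m" for x
      using edge[OF that] sub by (auto simp: compatibility_edges_def)
    show "inj_on \<phi> (cube m)"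
    proof (rule inj_onI)
      fix x x' assume x: "x \<in> cube m" "x' \<in> cube m" "\<phi> x = \<phi> x'"
      then show "x = x'"
        using inj_onD[OF inj(2) _ edge[OF x(1)] edge[OF x(2)]] by simp
    qed
  qed
  then show "\<exists>\<phi>. dominating m n w E \<phi>" by (rule exI[of "dominating m n w E"])
qed

end

declare One_nat_def [simp]

theorem theorem20:
  "\<exists>(p :: program) (C :: nat) (k :: nat).
     \<forall>(m :: nat) (n :: nat) (w :: nat) (E :: (nat \<times> nat) set).
       1 \<le> m \<longrightarrow> m \<le> n \<longrightarrow> 1 \<le> w \<longrightarrow> equitable m n E \<longrightarrow>
         finite (lp_vars (class_lp m n w E)) \<and>
         card (lp_vars (class_lp m n w E)) \<le> C * (m\<^sup>2 * w\<^sup>2) \<and>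
         finite (lp_constraints (class_lp m n w E)) \<and>
         card (lp_constraints (class_lp m n w E)) \<le> C * (m\<^sup>2 + w\<^sup>2) \<and>
         lp_optimal_value (class_lp m n w E)
           (real (max_matching_size (compatibility_edges m n w E))) \<and>
         ((\<exists>\<phi>. dominating m n w E \<phi>) \<longleftrightarrow> lp_optimal_value (class_lp m n w E) (2 ^ m)) \<and>
         (\<exists>s. runs_within (C * (m + w) ^ k) p m n w s \<and>
              lp_optimal_value (class_lp m n w E) (real (s 1)) \<and>
              s 0 = (if \<exists>\<phi>. dominating m n w E \<phi> then 1 else 0))"
proof (rule exI[of _ main_prog], rule exI[of _ 8000], rule exI[of _ 4], intro allI impI)
  fix m n w :: nat and E :: "(nat \<times> nat) set"
  assume mnw: "1 \<le> m" "m \<le> n" "1 \<le> w" and E: "equitable m n E"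
  interpret equitable_graph m n w E
    by unfold_locales (fact mnw E)+
  let ?L = "class_lp m n w E" and ?\<nu> = "max_matching_size (compatibility_edges m n w E)"
  have opt: "lp_optimal_value ?L (real ?\<nu>)"
    by (rule class_lp_optimal_value)
  \<comment> \<open>The two graphs meet here: both maximum matching sizes are the optimal value of
    the same program.\<close>
  have "real ?\<nu> = real (stair cost (Suc a) (Suc b))"
    using lp_optimal_value_unique[OF opt class_lp_optimal_value_blowup] by (simp only: max_matching_size_blowup)
  then have \<nu>: "stair cost (Suc a) (Suc b) = ?\<nu>"
    by (simp only: of_nat_eq_iff)
  obtain s where s: "runs_within (8000 * (m + w) ^ 4) main_prog m n w s" "s 0 = 1 - (2 ^ m - ?\<nu>)" "s 1 = ?\<nu>"
    using main_prog_runs_within unfolding \<nu> by blast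
  have dom: "(\<exists>\<phi>. dominating m n w E \<phi>) \<longleftrightarrow> lp_optimal_value ?L (2 ^ m)"
  proof
    assume "\<exists>\<phi>. dominating m n w E \<phi>"
    then show "lp_optimal_value ?L (2 ^ m)"
      using opt by (simp add: dominating_iff)
  next
    assume "lp_optimal_value ?L (2 ^ m)"
    then have "real ?\<nu> = real (2 ^ m)"
      using lp_optimal_value_unique[OF opt, of "2 ^ m"] by simp
    then show "\<exists>\<phi>. dominating m n w E \<phi>"
      unfolding dominating_iff by (simp only: of_nat_eq_iff)
  qed
  \<comment> \<open>As the matching size never exceeds \<open>2 ^ m\<close>, the truncated
    differences decide equality.\<close>
  have s0: "s 0 = (if \<exists>\<phi>. dominating m n w E \<phi> then 1 else 0)"
    unfolding dominating_iff s(2) using max_matching_size_le by auto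
  have "card (lp_vars ?L) \<le> 8000 * (m\<^sup>2 * w\<^sup>2)" "card (lp_constraints ?L) \<le> 8000 * (m\<^sup>2 + w\<^sup>2)"
    using class_lp_vars_bound(2) class_lp_constraints_bound(2) by linarith+
  then show "finite (lp_vars ?L) \<and> card (lp_vars ?L) \<le> 8000 * (m\<^sup>2 * w\<^sup>2) \<and>
      finite (lp_constraints ?L) \<and> card (lp_constraints ?L) \<le> 8000 * (m\<^sup>2 + w\<^sup>2) \<and>
      lp_optimal_value ?L (real ?\<nu>) \<and>
      ((\<exists>\<phi>. dominating m n w E \<phi>) \<longleftrightarrow> lp_optimal_value ?L (2 ^ m)) \<and>
      (\<exists>s. runs_within (8000 * (m + w) ^ 4) main_prog m n w s \<and>
        lp_optimal_value ?L (real (s 1)) \<and> s 0 = (if \<exists>\<phi>. dominating m n w E \<phi> then 1 else 0))"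
    using class_lp_vars_bound(1) class_lp_constraints_bound(1) opt dom s(1,3) s0 by (intro conjI exI[of _ s]) simp_all
qed

end
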